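(* Let $D$ be a hereditary subalgebra of a (possibly nonunital) $C^*$-algebra $B$, and let $L=\overline{BD}$ be the left ideal of $B$ associated with $D$. Then $D$ is proximinal in $L+L^*$.
   Context: $\overline{BD}$ denotes the norm closure of the linear span of products $bd$ with $b\in B$, $d\in D$. A subspace $E$ of a normed space $X$ is proximinal in $X$ if for every $x\in X$ there is a (not necessarily unique) $y\in E$ with $\|x-y\|=d(x,E)$. *)

theory Defs
  imports "HOL-Analysis.Analysis"
begin

(* Complex C*-algebras, with no unit assumed and the zero algebra allowed.  Completeness and the
   submultiplicative norm come from the parent classes; scaleR_scaleC makes the real scalar
   multiplication of those classes the restriction of the complex one. *)
class cstar_algebra = real_normed_algebra + banach +
  fixes scaleC :: "complex \<Rightarrow> 'a \<Rightarrow> 'a" (infixr \<open>*\<^sub>C\<close> 75)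
    and star :: "'a \<Rightarrow> 'a"
  assumes scaleC_add_right: "c *\<^sub>C (x + y) = c *\<^sub>C x + c *\<^sub>C y"
    and scaleC_add_left: "(c + d) *\<^sub>C x = c *\<^sub>C x + d *\<^sub>C x"
    and scaleC_scaleC: "c *\<^sub>C d *\<^sub>C x = (c * d) *\<^sub>C x"
    and scaleR_scaleC: "r *\<^sub>R x = complex_of_real r *\<^sub>C x"
    and mult_scaleC_left: "(c *\<^sub>C x) * y = c *\<^sub>C (x * y)"
    and mult_scaleC_right: "x * (c *\<^sub>C y) = c *\<^sub>C (x * y)"
    and norm_scaleC: "norm (c *\<^sub>C x) = cmod c * norm x"
    and star_star: "star (star x) = x"
    and star_add: "star (x + y) = star x + star y"
    and star_scaleC: "star (c *\<^sub>C x) = cnj c *\<^sub>C star x"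
    and star_mult: "star (x * y) = star y * star x"
    and cstar_identity: "norm (star x * x) = (norm x)\<^sup>2"

global_interpretation complex_vector: vector_space "scaleC :: complex \<Rightarrow> 'a \<Rightarrow> 'a::cstar_algebra"
proof
  show "1 *\<^sub>C x = x" for x :: 'a
    using scaleR_scaleC[of 1 x] by simp
qed (simp_all add: scaleC_add_right scaleC_add_left scaleC_scaleC)

(* The positive cone of the whole algebra, { x* x }; the order is a \<le> b iff b - a is positive. *)
definition cstar_positive :: "'a::cstar_algebra \<Rightarrow> bool"
  where "cstar_positive a \<longleftrightarrow> (\<exists>x. a = star x * x)"

definition cstar_le :: "'a::cstar_algebra \<Rightarrow> 'a \<Rightarrow> bool"
  where "cstar_le a b \<longleftrightarrow> cstar_positive (b - a)"

definition cstar_subalgebra :: "'a::cstar_algebra set \<Rightarrow> bool"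
  where "cstar_subalgebra D \<longleftrightarrow>
    complex_vector.subspace D \<and> closed D \<and>
    (\<forall>x\<in>D. \<forall>y\<in>D. x * y \<in> D) \<and> (\<forall>x\<in>D. star x \<in> D)"

definition hereditary_subalgebra :: "'a::cstar_algebra set \<Rightarrow> bool"
  where "hereditary_subalgebra D \<longleftrightarrow>
    cstar_subalgebra D \<and>
    (\<forall>a d. d \<in> D \<and> cstar_positive d \<and> cstar_positive a \<and> cstar_le a d \<longrightarrow> a \<in> D)"

definition closed_product :: "'a::cstar_algebra set \<Rightarrow> 'a set \<Rightarrow> 'a set"
  where "closed_product S T = closure (complex_vector.span {s * t | s t. s \<in> S \<and> t \<in> T})"

(* The library's infdist x E is the distance d(x,E); E is nonempty here, being a subspace. *)
definition proximinal :: "'a::cstar_algebra set \<Rightarrow> 'a set \<Rightarrow> bool"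
  where "proximinal E X \<longleftrightarrow>
    complex_vector.subspace X \<and> complex_vector.subspace E \<and> E \<subseteq> X \<and>
    (\<forall>x\<in>X. \<exists>y\<in>E. norm (x - y) = infdist x E)"

end

theory Submission
  imports Defs
begin

text \<open>
  Write the unit of the unitization as \<open>c\<^sup>2 + s\<^sup>2\<close> with commuting self-adjoint \<open>c \<in> D\<close> and \<open>s\<close>,
  where \<open>s\<close> almost annihilates given elements of \<open>L\<close>.  The isometry \<open>u \<mapsto> (c u, s u)\<close> turns
  \<open>x \<in> L + L\<^sup>*\<close> into a \<open>2 \<times> 2\<close> matrix with entries \<open>A = c x c\<close>, \<open>B = c x s\<close>, \<open>C = s x c\<close> and
  \<open>s x s \<approx> 0\<close>.  If \<open>\<parallel>x\<parallel> \<le> 1 + \<delta>\<close> and \<open>d(x, D) \<le> 1\<close>, then \<open>B\<close> and \<open>C\<close> are nearly contractions, and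
  Parrott's parametrisation of the possible corners \<open>A\<close> allows \<open>A\<close> to be replaced by some \<open>M\<close> at
  distance of order \<open>\<surd>\<delta>\<close> so that the new matrix has norm arbitrarily close to \<open>1\<close>.  This subtracts
  \<open>c (A - M) c\<close> from \<open>x\<close>, which lies in \<open>D\<close> because \<open>D\<close> is hereditary.  Repeating the step with
  \<open>\<delta> = 4\<^sup>-\<^sup>n\<close> gives a convergent series whose sum is a best approximation.
\<close>

section \<open>Square roots of perturbations of the unit\<close>

text \<open>Because \<open>s x s\<close> is almost zero, the centre of Parrott's family vanishes: up
  to an error, the corners allowed at level \<open>r\<close> are \<open>r P K Q\<close> with
  \<open>P\<^sup>2 = 1 - B B\<^sup>* / r\<^sup>2\<close>,
  \<open>Q\<^sup>2 = 1 - C\<^sup>* C / r\<^sup>2\<close> and \<open>K\<close> a contraction. The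
  obstacle is to find \<open>K\<close> inside a C*-algebra, where no weak limits are available. It
  is met by keeping a gap: \<open>B\<close> and \<open>C\<close> have norm at most
  \<open>\<beta>\<close>, strictly below the bound \<open>R\<close> for \<open>x\<close>, so at
  level \<open>R\<close> both \<open>P\<close> and \<open>Q\<close> are invertible and
  \<open>K\<close> is a quotient. The price is the distance between the roots at the two levels,
  hence the order of a square root. An exact annihilator of \<open>l\<close> and \<open>m\<close>
  need not exist. Heredity puts \<open>l\<^sup>* l\<close> and \<open>m\<^sup>* m\<close> into
  \<open>D\<close>, and a resolvent of an element above both makes \<open>l s\<close> and
  \<open>m s\<close> small. Roots and positivity rest on a recursion for
  \<open>1 - sqrt (1 - a)\<close> instead of a functional calculus; it makes sense without a
  unit.\<close>

primrec root_iter :: "'a::real_normed_algebra \<Rightarrow> nat \<Rightarrow> 'a" where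
  "root_iter a 0 = 0"
| "root_iter a (Suc k) = (1/2) *\<^sub>R (a + root_iter a k * root_iter a k)"

text \<open>The element \<open>g\<close> for which \<open>1 - g\<close> is the square root of \<open>1 - a\<close>.  The recursion
  has nonnegative coefficients, so the scalar iteration dominates it.\<close>

definition root_defect :: "'a::{real_normed_algebra,banach} \<Rightarrow> 'a" where
  "root_defect a = lim (root_iter a)"

lemma root_iter_commute:
  assumes "x * a = a * x"
  shows "x * root_iter a k = root_iter a k * x"
proof (induction k)
  case (Suc k)
  have "x * (root_iter a k * root_iter a k) = root_iter a k * root_iter a k * x"
    by (metis Suc mult.assoc)
  then show ?case
    using assms by (simp add: algebra_simps)
qed simp

lemma root_iter_real_range:
  fixes l :: real
  assumes "0 \<le> l" "l \<le> 1"
  shows "0 \<le> root_iter l k \<and> root_iter l k \<le> 1"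
proof (induction k)
  case (Suc k)
  then have "root_iter l k * root_iter l k \<le> 1"
    by (simp add: mult_le_one)
  with Suc assms show ?case by simp
qed simp

lemma norm_root_iter_le:
  assumes "norm a \<le> l"
  shows "norm (root_iter a k) \<le> root_iter l k"
proof (induction k)
  case (Suc k)
  have "norm (root_iter a k * root_iter a k) \<le> root_iter l k * root_iter l k"
    using Suc by (meson norm_mult_ineq mult_mono' norm_ge_zero order_trans)
  then have "norm (a + root_iter a k * root_iter a k) \<le> l + root_iter l k * root_iter l k"
    using assms norm_triangle_mono by blast
  then show ?case by simp
qed simp

lemma norm_square_diff_le:
  fixes u v :: "'a::real_normed_algebra"
  assumes "u * v = v * u" "norm (u - v) \<le> d" "norm u \<le> p" "norm v \<le> q"
  shows "norm (u * u - v * v) \<le> d * (p + q)"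
proof -
  have "u * u - v * v = (u - v) * (u + v)"
    using assms(1) by (simp add: algebra_simps)
  also have "norm \<dots> \<le> norm (u - v) * norm (u + v)"
    by (rule norm_mult_ineq)
  also have "\<dots> \<le> d * (p + q)"
    using assms norm_triangle_mono[of u p v q] by (intro mult_mono) (auto intro: order_trans[OF norm_ge_zero])
  finally show ?thesis .
qed

text \<open>All iterates are polynomials in \<open>a\<close> and commute, so a difference of squares
  factors, and both factors are dominated by their scalar counterparts. Convergence for every
  \<open>a\<close> thus follows from that of one bounded monotone real sequence.\<close>

lemma norm_root_iter_Suc_diff:
  assumes "norm a \<le> 1"
  shows "norm (root_iter a (Suc k) - root_iter a k) \<le> root_iter 1 (Suc k) - root_iter 1 k"
proof (induction k)
  case 0
  then show ?case using assms by simp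
next
  case (Suc k)
  let ?u = "root_iter a (Suc k)" and ?v = "root_iter a k"
  have c: "?u * ?v = ?v * ?u"
    by (intro root_iter_commute root_iter_commute[symmetric]) simp
  have "norm (?u * ?u - ?v * ?v)
      \<le> (root_iter 1 (Suc k) - root_iter 1 k) * (root_iter 1 (Suc k) + root_iter 1 k)"
    using norm_square_diff_le[OF c Suc norm_root_iter_le[OF assms] norm_root_iter_le[OF assms]] .
  also have "\<dots> = root_iter 1 (Suc k) * root_iter 1 (Suc k) - root_iter 1 k * root_iter 1 k"
    by (simp only: square_diff_square_factored mult.commute)
  finally have *: "norm (?u * ?u - ?v * ?v) \<le> \<dots>" .
  have "root_iter a (Suc (Suc k)) - root_iter a (Suc k) = (1/2) *\<^sub>R (?u * ?u - ?v * ?v)"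
    unfolding root_iter.simps(2)[of a "Suc k"] by (subst (2) root_iter.simps(2)) (simp only: scaleR_diff_right[symmetric], simp)
  moreover have "root_iter 1 (Suc (Suc k)) - root_iter 1 (Suc k)
      = (root_iter 1 (Suc k) * root_iter 1 (Suc k) - root_iter 1 k * root_iter 1 k) / (2::real)"
    unfolding root_iter.simps(2)[of 1 "Suc k"] by (subst (3) root_iter.simps(2)) (simp del: root_iter.simps add: field_simps)
  ultimately show ?case using * by (simp del: root_iter.simps)
qed

lemma root_iter_one_mono: "m \<le> n \<Longrightarrow> root_iter (1::real) m \<le> root_iter 1 n"
proof (rule lift_Suc_mono_le[of "root_iter 1"])
  show "root_iter (1::real) k \<le> root_iter 1 (Suc k)" for k
    using norm_root_iter_Suc_diff[of "1::real" k] by (simp del: root_iter.simps)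
qed

lemma norm_root_iter_diff:
  assumes "norm a \<le> 1" "m \<le> n"
  shows "norm (root_iter a n - root_iter a m) \<le> root_iter 1 n - root_iter 1 m"
  using assms(2)
proof (induction n rule: dec_induct)
  case (step n)
  have "norm (root_iter a (Suc n) - root_iter a m)
      \<le> norm (root_iter a (Suc n) - root_iter a n) + norm (root_iter a n - root_iter a m)"
    using norm_triangle_ineq[of "root_iter a (Suc n) - root_iter a n" "root_iter a n - root_iter a m"]
    by (simp only: diff_add_cancel add_diff_eq)
  with step norm_root_iter_Suc_diff[OF assms(1), of n] show ?case by linarith
qed simp

lemma root_iter_LIMSEQ:
  fixes a :: "'a::{real_normed_algebra,banach}"
  assumes "norm a \<le> 1"
  shows "root_iter a \<longlonglongrightarrow> root_defect a"
proof -
  have "Bseq (root_iter (1::real))"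
    by (rule BseqI'[of _ 1]) (use root_iter_real_range[of 1] in auto)
  then have conv: "Cauchy (root_iter (1::real))"
    using root_iter_one_mono by (intro convergent_Cauchy Bseq_mono_convergent) auto
  have "Cauchy (root_iter a)"
  proof (rule metric_CauchyI)
    fix e :: real assume "0 < e"
    with conv obtain M where M: "\<And>m n. m \<ge> M \<Longrightarrow> n \<ge> M \<Longrightarrow> dist (root_iter (1::real) m) (root_iter 1 n) < e"
      unfolding Cauchy_def by blast
    have "dist (root_iter a m) (root_iter a n) < e" if "m \<ge> M" "n \<ge> M" "m \<le> n" for m n
      using norm_root_iter_diff[OF assms that(3)] M[OF that(1,2)]
      by (simp add: dist_norm norm_minus_commute)
    then show "\<exists>M. \<forall>m\<ge>M. \<forall>n\<ge>M. dist (root_iter a m) (root_iter a n) < e"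
      by (metis dist_commute linear)
  qed
  then show ?thesis
    unfolding root_defect_def using Cauchy_convergent convergent_LIMSEQ_iff by blast
qed

text \<open>Expanding \<open>(1 - g)\<^sup>2 = 1 - a\<close> removes the unit, so the equation can
  be used in a nonunital algebra.\<close>

lemma root_defect_eq:
  fixes a :: "'a::{real_normed_algebra,banach}"
  assumes "norm a \<le> 1"
  shows "2 *\<^sub>R root_defect a - root_defect a * root_defect a = a"
proof -
  have "(\<lambda>k. root_iter a (Suc k)) \<longlonglongrightarrow> (1/2) *\<^sub>R (a + root_defect a * root_defect a)"
    unfolding root_iter.simps by (intro tendsto_intros root_iter_LIMSEQ assms)
  moreover have "(\<lambda>k. root_iter a (Suc k)) \<longlonglongrightarrow> root_defect a"
    by (rule LIMSEQ_Suc[OF root_iter_LIMSEQ[OF assms]])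
  ultimately have "root_defect a = (1/2) *\<^sub>R (a + root_defect a * root_defect a)"
    by (metis LIMSEQ_unique)
  then have "2 *\<^sub>R root_defect a = a + root_defect a * root_defect a"
    by (metis scaleR_scaleR scaleR_one nonzero_mult_div_cancel_left times_divide_eq_right zero_neq_numeral mult_1_right)
  then show ?thesis by simp
qed

lemma root_defect_real:
  fixes l :: real
  assumes "0 \<le> l" "l \<le> 1"
  shows "root_defect l = 1 - sqrt (1 - l)"
proof -
  have "root_defect l \<le> 1"
    by (rule LIMSEQ_le_const2[OF root_iter_LIMSEQ]) (use assms root_iter_real_range[OF assms] in auto)
  moreover have "(1 - root_defect l)\<^sup>2 = 1 - l"
    using root_defect_eq[of l] assms by (simp add: power2_eq_square algebra_simps)
  ultimately have "sqrt (1 - l) = 1 - root_defect l"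
    by (intro real_sqrt_unique) auto
  then show ?thesis by simp
qed

lemma norm_root_defect_le:
  fixes a :: "'a::{real_normed_algebra,banach}"
  assumes "norm a \<le> l" "l \<le> 1"
  shows "norm (root_defect a) \<le> 1 - sqrt (1 - l)"
proof -
  have l: "0 \<le> l" using assms norm_ge_zero order_trans by blast
  have "norm (root_defect a) \<le> root_defect l"
    by (rule LIMSEQ_le[OF tendsto_norm[OF root_iter_LIMSEQ] root_iter_LIMSEQ])
       (use assms l norm_root_iter_le in auto)
  then show ?thesis using root_defect_real l assms(2) by simp
qed

lemma root_defect_commute:
  fixes a :: "'a::{real_normed_algebra,banach}"
  assumes "norm a \<le> 1" "x * a = a * x"
  shows "x * root_defect a = root_defect a * x"
proof -
  have "(\<lambda>k. x * root_iter a k) \<longlonglongrightarrow> x * root_defect a"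
    "(\<lambda>k. root_iter a k * x) \<longlonglongrightarrow> root_defect a * x"
    by (intro tendsto_intros root_iter_LIMSEQ assms)+
  then show ?thesis
    unfolding root_iter_commute[OF assms(2)] by (metis LIMSEQ_unique)
qed

text \<open>The scalar difference on the right tends to \<open>sqrt (1 - l)\<close>. This is the
  source of the order of the corrections: it bounds the change of the roots when the level drops
  from \<open>R\<close> to \<open>\<beta>\<close>.\<close>

lemma norm_root_iter_scale_diff:
  fixes b :: "'a::real_normed_algebra"
  assumes "norm b \<le> 1" "0 \<le> l" "l \<le> 1"
  shows "norm (root_iter b k - root_iter (l *\<^sub>R b) k) \<le> root_iter 1 k - root_iter l k"
proof (induction k)
  case (Suc k)
  let ?u = "root_iter b k" and ?v = "root_iter (l *\<^sub>R b) k"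
  have lb: "norm (l *\<^sub>R b) \<le> l"
    using assms by (simp add: mult_left_le)
  have c: "?u * ?v = ?v * ?u"
    by (intro root_iter_commute root_iter_commute[symmetric]) (simp add: root_iter_commute)
  have "norm (?u * ?u - ?v * ?v) \<le> (root_iter 1 k - root_iter l k) * (root_iter 1 k + root_iter l k)"
    using norm_square_diff_le[OF c Suc norm_root_iter_le[OF assms(1)] norm_root_iter_le[OF lb]] .
  also have "\<dots> = root_iter 1 k * root_iter 1 k - root_iter l k * root_iter l k"
    by (simp add: algebra_simps)
  finally have *: "norm (?u * ?u - ?v * ?v) \<le> \<dots>" .
  have "norm ((1 - l) *\<^sub>R b) \<le> 1 - l"
    using assms by (simp add: mult_left_le)
  then have "norm ((1 - l) *\<^sub>R b + (?u * ?u - ?v * ?v))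
      \<le> (1 - l) + (root_iter 1 k * root_iter 1 k - root_iter l k * root_iter l k)"
    using * by (rule norm_triangle_mono)
  moreover have "root_iter b (Suc k) - root_iter (l *\<^sub>R b) (Suc k)
      = (1/2) *\<^sub>R ((1 - l) *\<^sub>R b + (?u * ?u - ?v * ?v))"
    by (simp add: algebra_simps)
  moreover have "root_iter 1 (Suc k) - root_iter l (Suc k) = (1/2) *
      ((1 - l) + (root_iter 1 k * root_iter 1 k - root_iter l k * root_iter l k))"
    by (simp add: algebra_simps)
  ultimately show ?case by (simp only: norm_scaleR) simp
qed simp

lemma norm_root_defect_scale_diff:
  fixes b :: "'a::{real_normed_algebra,banach}"
  assumes "norm b \<le> 1" "0 \<le> l" "l \<le> 1"
  shows "norm (root_defect b - root_defect (l *\<^sub>R b)) \<le> sqrt (1 - l)"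
proof -
  have lb: "norm (l *\<^sub>R b) \<le> 1"
    using assms by (simp add: mult_le_one)
  have "norm (root_defect b - root_defect (l *\<^sub>R b)) \<le> root_defect 1 - root_defect l"
    by (rule LIMSEQ_le[OF tendsto_norm[OF tendsto_diff[OF root_iter_LIMSEQ root_iter_LIMSEQ]]
          tendsto_diff[OF root_iter_LIMSEQ root_iter_LIMSEQ]])
       (use assms lb norm_root_iter_scale_diff[OF assms] in auto)
  then show ?thesis using root_defect_real[of l] root_defect_real[of 1] assms by simp
qed

section \<open>Positivity in unital algebras\<close>

lemma star_scaleR: "star (r *\<^sub>R x) = r *\<^sub>R star x" for x :: "'a::cstar_algebra"
  by (simp add: scaleR_scaleC star_scaleC)

lemma star_minus: "star (- x) = - star x" for x :: "'a::cstar_algebra"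
  using star_scaleR[of "-1" x] by simp

lemma star_diff: "star (x - y) = star x - star y" for x y :: "'a::cstar_algebra"
  using star_add[of x "-y"] by (simp add: star_minus)

lemma star_zero: "star (0::'a::cstar_algebra) = 0"
  using star_diff[of 0 0] by simp

lemma scaleC_one: "1 *\<^sub>C x = x"
  by (rule complex_vector.scale_one)

lemma scaleC_minus_left: "(- c) *\<^sub>C x = - (c *\<^sub>C x)"
  by (rule complex_vector.scale_minus_left)

lemmas star_simps = star_star star_add star_diff star_minus star_scaleR star_scaleC star_mult star_zero

lemma norm_star: "norm (star x) = norm x" for x :: "'a::cstar_algebra"
proof -
  have "norm y \<le> norm (star y)" for y :: 'a
    using cstar_identity[of y] norm_mult_ineq[of "star y" y]
    by (cases "y = 0") (auto simp: power2_eq_square)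
  from this[of x] this[of "star x"] show ?thesis by (simp add: star_star)
qed

lemma norm_mult_star: "norm (x * star x) = (norm x)\<^sup>2" for x :: "'a::cstar_algebra"
  using cstar_identity[of "star x"] by (simp add: star_star norm_star)

lemma star_tendsto:
  fixes f :: "'b \<Rightarrow> 'a::cstar_algebra"
  assumes "(f \<longlongrightarrow> l) F"
  shows "((\<lambda>x. star (f x)) \<longlongrightarrow> star l) F"
proof -
  have "bounded_linear (star :: 'a \<Rightarrow> 'a)"
    by (rule bounded_linear_intro[of _ 1]) (simp_all add: star_add star_scaleR norm_star)
  then show ?thesis using assms bounded_linear.tendsto by blast
qed

lemma star_root_defect:
  fixes a :: "'a::cstar_algebra"
  assumes "norm a \<le> 1" "star a = a"
  shows "star (root_defect a) = root_defect a"
proof -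
  have "star (root_iter a k) = root_iter a k" for k
    by (induction k) (simp_all add: star_simps assms)
  then show ?thesis
    using star_tendsto[OF root_iter_LIMSEQ[OF assms(1)]] root_iter_LIMSEQ[OF assms(1)]
    by (simp add: LIMSEQ_unique)
qed

class unital_cstar_algebra = cstar_algebra + real_normed_algebra_1

lemma star_one: "star (1::'a::unital_cstar_algebra) = 1"
  by (metis mult_1_right star_mult star_star)

definition root1m :: "'a::unital_cstar_algebra \<Rightarrow> 'a" where
  "root1m a = 1 - root_defect a"

lemma root1m:
  fixes a :: "'a::unital_cstar_algebra"
  assumes "norm a \<le> 1" "star a = a"
  shows root1m_square: "root1m a * root1m a = 1 - a"
    and star_root1m: "star (root1m a) = root1m a"
    and norm_one_minus_root1m: "norm (1 - root1m a) \<le> 1"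
proof -
  show "root1m a * root1m a = 1 - a"
    using root_defect_eq[OF assms(1)] unfolding root1m_def
    by (simp add: algebra_simps scaleR_2)
  show "star (root1m a) = root1m a"
    unfolding root1m_def using star_root_defect[OF assms] by (simp add: star_simps star_one)
  show "norm (1 - root1m a) \<le> 1"
    unfolding root1m_def using norm_root_defect_le[of a 1] assms by simp
qed

lemma root1m_commute:
  fixes a :: "'a::unital_cstar_algebra"
  assumes "norm a \<le> 1" "x * a = a * x"
  shows "x * root1m a = root1m a * x"
  unfolding root1m_def using root_defect_commute[OF assms] by (simp add: algebra_simps)

lemma star_mult_commuting_parts:
  fixes r v :: "'a::cstar_algebra"
  assumes "star r = r" "star v = v" "r * v = v * r"
  shows "star (r + \<i> *\<^sub>C v) * (r + \<i> *\<^sub>C v) = r * r + v * v"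
  using assms
  by (simp add: star_simps algebra_simps mult_scaleC_left mult_scaleC_right scaleC_scaleC
      scaleC_minus_left scaleC_one)

text \<open>The element \<open>r\<close> is the real part of \<open>r + \<i> *\<^sub>C v\<close>,
  whose C*-identity produces \<open>r * r + v * v\<close>. The norm comparisons of positive elements
  below reduce to this inequality, applied to commuting roots.\<close>

lemma norm_square_le_commuting:
  fixes r v :: "'a::cstar_algebra"
  assumes "star r = r" "star v = v" "r * v = v * r"
  shows "(norm r)\<^sup>2 \<le> norm (r * r + v * v)"
proof -
  define u where "u = r + \<i> *\<^sub>C v"
  have u: "(norm u)\<^sup>2 = norm (r * r + v * v)"
    unfolding u_def using star_mult_commuting_parts[OF assms] cstar_identity by metis
  have "r = (1/2) *\<^sub>R (u + star u)"
    unfolding u_def using assms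
    by (simp add: star_simps scaleC_minus_left scaleR_2[symmetric])
  then have "norm r = (1/2) * norm (u + star u)" by (metis abs_numeral abs_divide abs_one norm_scaleR)
  then have "norm r \<le> norm u"
    using norm_triangle_ineq[of u "star u"] by (simp add: norm_star)
  then show ?thesis using u by (metis norm_ge_zero power_mono)
qed

text \<open>For self-adjoint \<open>a\<close> the norm condition says that the spectrum of \<open>a\<close> lies in \<open>[0, 2t]\<close>.\<close>

definition pos :: "'a::unital_cstar_algebra \<Rightarrow> bool" where
  "pos a \<longleftrightarrow> star a = a \<and> (\<exists>t. norm (t *\<^sub>R 1 - a) \<le> t)"

lemma pos_star: "pos a \<Longrightarrow> star a = a"
  by (simp add: pos_def)

lemma pos_zero: "pos 0"
  unfolding pos_def by (auto simp: star_zero intro: exI[of _ 0])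

lemma pos_add:
  assumes "pos a" "pos b"
  shows "pos (a + b)"
proof -
  obtain s t where "norm (s *\<^sub>R 1 - a) \<le> s" "norm (t *\<^sub>R 1 - b) \<le> t"
    using assms by (auto simp: pos_def)
  then have "norm ((s *\<^sub>R 1 - a) + (t *\<^sub>R 1 - b)) \<le> s + t"
    by (rule norm_triangle_mono)
  then have "norm ((s + t) *\<^sub>R 1 - (a + b)) \<le> s + t"
    by (simp add: algebra_simps)
  then show ?thesis
    using assms by (auto simp: pos_def star_add)
qed

lemma pos_scaleR:
  assumes "pos a" "0 \<le> r"
  shows "pos (r *\<^sub>R a)"
proof -
  obtain t where t: "norm (t *\<^sub>R 1 - a) \<le> t"
    using assms by (auto simp: pos_def)
  have "norm ((r * t) *\<^sub>R 1 - r *\<^sub>R a) = r * norm (t *\<^sub>R 1 - a)"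
    using assms(2) by (metis abs_of_nonneg norm_scaleR scaleR_diff_right scaleR_scaleR)
  then show ?thesis
    using assms t unfolding pos_def
    by (auto simp: star_scaleR intro!: exI[of _ "r * t"] mult_left_mono)
qed

lemma pos_norm_diff:
  assumes "star b = b"
  shows "pos (norm b *\<^sub>R 1 - b)"
  unfolding pos_def using assms by (auto simp: star_simps star_one intro!: exI[of _ "norm b"])

lemma pos_scaleR_one: "0 \<le> t \<Longrightarrow> pos (t *\<^sub>R 1)"
  unfolding pos_def by (auto simp: star_simps star_one intro!: exI[of _ t])

text \<open>Dividing by the \<open>t\<close> of \<open>pos\<close> turns \<open>a\<close> into
  \<open>1 - b\<close> with \<open>norm b \<le> 1\<close>. The commutation clause is part of the
  conclusion because later arguments combine roots of different elements.\<close>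

lemma pos_sqrt:
  assumes "pos a"
  obtains r where "star r = r" "r * r = a" "pos r" "\<And>x. x * a = a * x \<Longrightarrow> x * r = r * x"
proof -
  obtain t where t: "norm (t *\<^sub>R 1 - a) \<le> t"
    using assms by (auto simp: pos_def)
  have t0: "0 \<le> t" using t norm_ge_zero order_trans by blast
  show thesis
  proof (cases "t = 0")
    case True
    then show thesis using t that[of 0] pos_zero by (auto simp: star_zero)
  next
    case False
    define b where "b = 1 - (1/t) *\<^sub>R a"
    have "b = (1/t) *\<^sub>R (t *\<^sub>R 1 - a)"
      unfolding b_def using False by (simp add: scaleR_diff_right)
    then have "norm b = (1/t) * norm (t *\<^sub>R 1 - a)"
      using t0 by simp
    then have nb: "norm b \<le> 1"
      using t t0 False by (simp add: divide_le_eq)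
    have sb: "star b = b"
      using pos_star[OF assms] unfolding b_def by (simp add: star_simps star_one)
    define r where "r = sqrt t *\<^sub>R root1m b"
    have "norm (sqrt t *\<^sub>R 1 - r) = sqrt t * norm (1 - root1m b)"
      unfolding r_def using t0 by (metis abs_of_nonneg norm_scaleR real_sqrt_ge_zero scaleR_diff_right)
    also have "\<dots> \<le> sqrt t"
      using norm_one_minus_root1m[OF nb sb] t0 by (simp add: mult_left_le)
    finally have nr: "norm (sqrt t *\<^sub>R 1 - r) \<le> sqrt t" .
    have sr: "star r = r"
      unfolding r_def by (simp add: star_scaleR star_root1m[OF nb sb])
    have rr: "r * r = a"
      unfolding r_def using root1m_square[OF nb sb] t0 False by (simp add: b_def)
    have comm: "x * r = r * x" if "x * a = a * x" for x
    proof -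
      have "x * b = b * x" unfolding b_def using that by (simp add: algebra_simps)
      then show ?thesis unfolding r_def using root1m_commute[OF nb] by simp
    qed
    have pr: "pos r"
      unfolding pos_def using sr nr by blast
    show thesis
      by (rule that[OF sr rr pr comm])
  qed
qed

lemma pos_square:
  assumes "star b = b"
  shows "pos (b * b)"
proof -
  \<comment> \<open>The root \<open>v\<close> of \<open>1 - b * b\<close> commutes with
    \<open>b\<close>, and the two squares add up to \<open>1\<close>; hence \<open>v\<close> is a
    contraction.\<close>
  have *: "norm (1 - b * b) \<le> 1" if b: "star b = b" "norm b \<le> 1" for b :: 'a
  proof -
    define v where "v = root1m (b * b)"
    have n: "norm (b * b) \<le> 1" "star (b * b) = b * b"
      using b norm_mult_ineq[of b b] mult_le_one[of "norm b" "norm b"] by (auto simp: star_simps)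
    have v: "star v = v" "v * v = 1 - b * b" "b * v = v * b"
      unfolding v_def using star_root1m[OF n] root1m_square[OF n] root1m_commute[OF n(1), of b]
      by (auto simp: mult.assoc)
    have "(norm v)\<^sup>2 \<le> norm (v * v + b * b)"
      using norm_square_le_commuting[of v b] v b by simp
    then have "(norm v)\<^sup>2 \<le> 1" using v(2) by simp
    then show ?thesis
      using v(2) norm_mult_ineq[of v v] by (simp add: power2_eq_square)
  qed
  show ?thesis
  proof (cases "b = 0")
    case True
    then show ?thesis by (simp add: pos_zero)
  next
    case False
    define d where "d = (1 / norm b) *\<^sub>R b"
    have "norm (1 - d * d) \<le> 1"
      by (rule *) (use assms False in \<open>simp_all add: d_def star_scaleR\<close>)
    then have "pos (d * d)"
      unfolding pos_def using assms by (auto simp: d_def star_simps intro!: exI[of _ 1])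
    then have "pos ((norm b)\<^sup>2 *\<^sub>R (d * d))"
      by (rule pos_scaleR) simp
    then show ?thesis
      using False by (simp add: d_def power2_eq_square)
  qed
qed

text \<open>Roots of \<open>a\<close> and \<open>- a\<close> commute, and their squares add up to
  zero.\<close>

lemma pos_antisym:
  assumes "pos a" "pos (- a)"
  shows "a = 0"
proof -
  obtain r where r: "star r = r" "r * r = a" "\<And>x. x * a = a * x \<Longrightarrow> x * r = r * x"
    using pos_sqrt[OF assms(1)] by metis
  obtain v where v: "star v = v" "v * v = - a" "\<And>x. x * (- a) = (- a) * x \<Longrightarrow> x * v = v * x"
    using pos_sqrt[OF assms(2)] by metis
  have "r * (- a) = (- a) * r"
    using r(2) by (metis minus_mult_left minus_mult_right mult.assoc)
  then have "r * v = v * r" by (rule v(3))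
  then have "(norm r)\<^sup>2 \<le> norm (r * r + v * v)"
    by (intro norm_square_le_commuting r(1) v(1))
  then show ?thesis using r(2) v(2) by simp
qed

text \<open>Roots of \<open>a\<close> and \<open>t - a\<close> commute, and their squares add up to
  \<open>t\<close>.\<close>

lemma norm_le_of_pos:
  assumes "pos a" "pos (t *\<^sub>R 1 - a)" "0 \<le> t"
  shows "norm a \<le> t"
proof -
  obtain r where r: "star r = r" "r * r = a"
    using pos_sqrt[OF assms(1)] by metis
  obtain v where v: "star v = v" "v * v = t *\<^sub>R 1 - a"
      "\<And>x. x * (t *\<^sub>R 1 - a) = (t *\<^sub>R 1 - a) * x \<Longrightarrow> x * v = v * x"
    using pos_sqrt[OF assms(2)] by metis
  have "r * a = a * r" using r(2) by (metis mult.assoc)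
  then have "r * (t *\<^sub>R 1 - a) = (t *\<^sub>R 1 - a) * r"
    by (simp add: right_diff_distrib left_diff_distrib)
  then have "r * v = v * r" by (rule v(3))
  then have "(norm r)\<^sup>2 \<le> norm (r * r + v * v)"
    by (intro norm_square_le_commuting r(1) v(1))
  then have "(norm r)\<^sup>2 \<le> t" using r(2) v(2) assms(3) by simp
  then show ?thesis using cstar_identity[of r] r by simp
qed

lemma pos_norm_mono:
  assumes "pos a" "pos (b - a)"
  shows "norm a \<le> norm b"
proof -
  have "star b = b"
    using pos_star[OF pos_add[OF assms]] by simp
  then have "pos ((b - a) + (norm b *\<^sub>R 1 - b))"
    using assms(2) pos_norm_diff pos_add by blast
  then show ?thesis
    by (intro norm_le_of_pos[OF assms(1)]) auto
qed

lemma star_real_part: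
  obtains p q :: "'a::cstar_algebra" where "star p = p" "star q = q" "y = p + \<i> *\<^sub>C q"
proof (rule that)
  show "star ((1/2) *\<^sub>R (y + star y)) = (1/2) *\<^sub>R (y + star y)"
    by (simp add: star_simps add.commute)
  show "star ((- \<i> / 2) *\<^sub>C (y - star y)) = (- \<i> / 2) *\<^sub>C (y - star y)"
    by (simp add: star_simps scaleC_minus_left complex_vector.scale_right_diff_distrib)
  show "y = (1/2) *\<^sub>R (y + star y) + \<i> *\<^sub>C ((- \<i> / 2) *\<^sub>C (y - star y))"
    by (simp add: scaleC_scaleC scaleR_scaleC flip: complex_vector.scale_left_distrib)
       (simp add: scaleC_add_right complex_vector.scale_right_diff_distrib
         flip: scaleC_add_left)
qed

section \<open>Positivity of \<open>star x * x\<close>\<close>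

lemma norm_power2_power:
  fixes a :: "'a::unital_cstar_algebra"
  assumes "star a = a"
  shows "norm (a ^ (2 ^ k)) = norm a ^ (2 ^ k)"
proof (induction k)
  case (Suc k)
  have s: "star (a ^ n) = a ^ n" for n
    by (induction n) (simp_all add: star_one star_mult assms power_commutes)
  have "norm (a ^ (2 ^ Suc k)) = norm (star (a ^ (2 ^ k)) * a ^ (2 ^ k))"
    by (simp add: s mult_2 power_add)
  also have "\<dots> = (norm a ^ (2 ^ k))\<^sup>2"
    by (simp only: cstar_identity Suc)
  finally show ?case by (simp add: power_mult[symmetric] mult.commute)
qed simp

text \<open>After division by \<open>R ^ (2 ^ k)\<close> the right side would tend to zero if
  \<open>t < R\<close>. This stands in for the spectral radius formula; exponents
  \<open>2 ^ k\<close> are enough because the norms of those powers of a self-adjoint element are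
  known exactly.\<close>

lemma subexponential_le:
  fixes R t C :: real
  assumes "0 < t" and le: "\<And>k. R ^ (2 ^ k) \<le> t ^ (2 ^ k) + C * real (2 ^ k) * t ^ (2 ^ k)"
  shows "R \<le> t"
proof (rule ccontr)
  assume "\<not> R \<le> t"
  then have R: "t < R" "0 < R" using assms by auto
  define q where "q = t / R"
  have q: "0 < q" "q < 1" using R assms by (auto simp: q_def)
  have "(\<lambda>n. q ^ n + C * (real n * q ^ n)) \<longlonglongrightarrow> 0 + C * 0"
    using q by (intro tendsto_intros powser_times_n_limit_0 LIMSEQ_power_zero) auto
  then have "(\<lambda>n. q ^ n + C * (real n * q ^ n)) \<longlonglongrightarrow> 0" by simp
  moreover have "filterlim (\<lambda>k. 2 ^ k :: nat) sequentially sequentially"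
    by (rule filterlim_subseq) (simp add: strict_mono_def)
  ultimately have "(\<lambda>k. q ^ (2 ^ k) + C * (real (2 ^ k) * q ^ (2 ^ k))) \<longlonglongrightarrow> 0"
    by (rule filterlim_compose)
  moreover have "1 \<le> q ^ (2 ^ k) + C * (real (2 ^ k) * q ^ (2 ^ k))" for k
    using le[of k] R by (simp add: q_def field_simps)
  ultimately have "1 \<le> (0::real)"
    by (intro LIMSEQ_le_const) auto
  then show False by simp
qed

text \<open>The nonzero spectra of \<open>y\<^sup>* y\<close> and \<open>y y\<^sup>*\<close> agree; here this takes the form of
  \<open>p (y y\<^sup>*) = p 0 + y q (y\<^sup>* y) y\<^sup>*\<close> for the polynomial \<open>p s = (t + s) ^ n = p 0 + s q s\<close>.\<close>

lemma pos_minus_swap: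
  fixes y :: "'a::unital_cstar_algebra"
  assumes "pos (- (star y * y))"
  shows "pos (- (y * star y))"
proof -
  obtain t0 where t0: "norm (t0 *\<^sub>R 1 + star y * y) \<le> t0"
    using assms by (auto simp: pos_def)
  \<comment> \<open>The shift by one keeps the norm bound and makes \<open>t\<close> strictly
    positive, as the later division by \<open>t\<close> requires.\<close>
  define t where "t = t0 + 1"
  have tt: "0 < t" unfolding t_def using t0 by (metis add_nonneg_pos norm_ge_zero order_trans zero_less_one)
  have "norm ((t0 *\<^sub>R 1 + star y * y) + 1) \<le> t0 + 1"
    by (rule norm_triangle_mono[OF t0]) simp
  then have t: "norm (t *\<^sub>R 1 + star y * y) \<le> t"
    unfolding t_def by (simp add: algebra_simps)
  let ?z = "t *\<^sub>R 1 + y * star y"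
  have "\<exists>q. ?z ^ n = t ^ n *\<^sub>R 1 + y * q * star y \<and> norm q * t \<le> real n * t ^ n" for n
  proof (induction n)
    case 0
    show ?case by (intro exI[of _ 0]) simp
  next
    case (Suc n)
    then obtain q where q: "?z ^ n = t ^ n *\<^sub>R 1 + y * q * star y" "norm q * t \<le> real n * t ^ n"
      by blast
    \<comment> \<open>This collects what stands between \<open>y\<close> and \<open>star y\<close>
      when \<open>t ^ n + y * q * star y\<close> is multiplied on the left by
      \<open>t + y * star y\<close>.\<close>
    define q' where "q' = t ^ n *\<^sub>R 1 + (t *\<^sub>R 1 + star y * y) * q"
    have "?z ^ Suc n = t ^ Suc n *\<^sub>R 1 + y * q' * star y"
      unfolding q'_def power_Suc q(1) by (simp add: algebra_simps)
    moreover have "norm q' \<le> t ^ n + t * norm q"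
    proof -
      have "norm ((t *\<^sub>R 1 + star y * y) * q) \<le> t * norm q"
        using t by (meson mult_right_mono norm_ge_zero norm_mult_ineq order_trans)
      then show ?thesis
        unfolding q'_def using tt by (intro norm_triangle_mono) simp_all
    qed
    then have "norm q' * t \<le> (t ^ n + t * norm q) * t"
      using tt by (intro mult_right_mono) auto
    then have "norm q' * t \<le> t ^ Suc n + t * (norm q * t)"
      by (simp add: algebra_simps)
    moreover have "t * (norm q * t) \<le> t * (real n * t ^ n)"
      using q(2) tt by (intro mult_left_mono) auto
    ultimately show ?case
      by (intro exI[of _ q']) (simp add: algebra_simps)
  qed
  then obtain q where q: "\<And>n. ?z ^ n = t ^ n *\<^sub>R 1 + y * q n * star y"
      "\<And>n. norm (q n) * t \<le> real n * t ^ n"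
    by metis
  have bound: "norm (?z ^ n) \<le> t ^ n + (norm y)\<^sup>2 / t * real n * t ^ n" for n
  proof -
    have "norm (y * q n * star y) \<le> norm (y * q n) * norm (star y)"
      by (rule norm_mult_ineq)
    also have "\<dots> \<le> norm y * norm (q n) * norm y"
      unfolding norm_star by (intro mult_right_mono norm_mult_ineq norm_ge_zero)
    also have "\<dots> = (norm y)\<^sup>2 / t * (norm (q n) * t)"
      using tt by (simp add: power2_eq_square)
    also have "\<dots> \<le> (norm y)\<^sup>2 / t * (real n * t ^ n)"
      using q(2)[of n] tt by (intro mult_left_mono) auto
    finally show ?thesis
      unfolding q(1)[of n] using tt by (intro norm_triangle_mono) (simp_all add: algebra_simps)
  qed
  have sz: "star ?z = ?z" by (simp add: star_simps star_one)
  have "norm ?z ^ (2 ^ k) \<le> t ^ (2 ^ k) + (norm y)\<^sup>2 / t * real (2 ^ k) * t ^ (2 ^ k)" for k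
    using bound[of "2 ^ k"] by (simp only: norm_power2_power[OF sz])
  then have "norm ?z \<le> t" using subexponential_le[OF tt] by blast
  then show ?thesis
    unfolding pos_def by (auto simp: star_simps intro!: exI[of _ t])
qed

lemma selfadjoint_square_zero: "star z = z \<Longrightarrow> z * z = 0 \<Longrightarrow> z = (0::'a::cstar_algebra)"
  using cstar_identity[of z] by simp

text \<open>With \<open>m\<close> the modulus of \<open>h\<close>, the element
  \<open>z = m - h\<close> is twice the negative part of \<open>h\<close>, and
  \<open>y = x * z\<close> satisfies \<open>star y * y = - (k * z)\<^sup>2\<close>. The swap lemma
  carries this sign over to \<open>y * star y\<close>, while \<open>star y * y + y * star y\<close>
  is a sum of squares. So \<open>star y * y\<close> is both positive and negative, \<open>y\<close>
  vanishes, and \<open>h\<close> equals its modulus.\<close>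

theorem pos_star_mult:
  fixes x :: "'a::unital_cstar_algebra"
  shows "pos (star x * x)"
proof -
  define h where "h = star x * x"
  have sh: "star h = h" unfolding h_def by (simp add: star_simps)
  obtain m where m: "star m = m" "m * m = h * h" "pos m" "\<And>u. u * (h * h) = (h * h) * u \<Longrightarrow> u * m = m * u"
    by (rule pos_sqrt[OF pos_square[OF sh]]) blast
  have hm: "h * m = m * h" by (rule m(4)) (simp add: mult.assoc)
  obtain k where k: "star k = k" "k * k = m" "\<And>u. u * m = m * u \<Longrightarrow> u * k = k * u"
    by (rule pos_sqrt[OF m(3)]) blast
  define z where "z = m - h"
  have sz: "star z = z" unfolding z_def using sh m(1) by (simp add: star_simps)
  have zm: "z * m = m * z" unfolding z_def using hm by (simp add: algebra_simps)
  have zk: "z * k = k * z" by (rule k(3)[OF zm])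
  have hz: "h * z = - (m * z)" unfolding z_def using hm m(2) by (simp add: algebra_simps)
  have "z * h * z = - (z * m * z)" by (simp add: mult.assoc hz)
  also have "z * m * z = (k * z) * (k * z)" by (simp add: k(2)[symmetric] zk mult.assoc[symmetric])
  finally have zhz: "z * h * z = - ((k * z) * (k * z))" .
  define y where "y = x * z"
  have yy: "star y * y = z * h * z"
    unfolding y_def h_def by (simp add: star_simps sz mult.assoc)
  have "star (k * z) = k * z" using k(1) sz zk by (simp add: star_simps)
  then have neg: "pos (- (star y * y))"
    unfolding yy zhz using pos_square by simp
  obtain p q where pq: "star p = p" "star q = q" "y = p + \<i> *\<^sub>C q"
    by (rule star_real_part)
  have "star y * y + y * star y = 2 *\<^sub>R (p * p + q * q)"
    unfolding pq(3) using pq(1,2)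
    by (simp add: star_simps algebra_simps mult_scaleC_left mult_scaleC_right scaleC_scaleC
      scaleC_minus_left scaleC_one scaleR_2)
  moreover have "pos (2 *\<^sub>R (p * p + q * q))"
    by (intro pos_scaleR pos_add pos_square pq) simp
  ultimately have "pos ((star y * y + y * star y) + - (y * star y))"
    using pos_minus_swap[OF neg] by (metis pos_add)
  then have "star y * y = 0"
    using neg by (intro pos_antisym) auto
  then have "y = 0" using cstar_identity[of y] by simp
  then have "h * z = 0" unfolding h_def y_def by (simp add: mult.assoc)
  \<comment> \<open>Since \<open>m * z = - (h * z)\<close>, the square of \<open>z\<close> is
    \<open>- 2 * h * z\<close>.\<close>
  then have "z * z = 0"
    using hz unfolding z_def by (simp add: algebra_simps hm)
  then have "z = 0" by (rule selfadjoint_square_zero[OF sz])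
  then show ?thesis
    using m(3) unfolding h_def[symmetric] z_def by simp
qed

lemma pos_mult_star: "pos (x * star x)"
  using pos_star_mult[of "star x"] by (simp add: star_star)

lemma pos_conj:
  assumes "pos a"
  shows "pos (star y * a * y)"
proof -
  obtain r where r: "star r = r" "r * r = a"
    using pos_sqrt[OF assms] by metis
  have "star y * a * y = star (r * y) * (r * y)"
    unfolding r(2)[symmetric] by (simp add: star_mult r(1) mult.assoc)
  then show ?thesis using pos_star_mult by metis
qed

lemma norm_le_of_pos_star:
  assumes "pos (k\<^sup>2 *\<^sub>R 1 - star z * z)" "0 \<le> k"
  shows "norm z \<le> k"
proof -
  have "(norm z)\<^sup>2 \<le> k\<^sup>2"
    using norm_le_of_pos[OF pos_star_mult assms(1)] by (simp add: cstar_identity)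
  then show ?thesis using assms(2) by (rule power2_le_imp_le)
qed

section \<open>Row--column estimates and corners\<close>

lemma pos_of_norm_le:
  fixes z :: "'a::unital_cstar_algebra"
  assumes "norm z \<le> k"
  shows "pos (k\<^sup>2 *\<^sub>R 1 - star z * z)"
proof -
  have "pos (norm (star z * z) *\<^sub>R 1 - star z * z)"
    by (rule pos_norm_diff) (simp add: star_simps)
  moreover have "pos ((k\<^sup>2 - norm (star z * z)) *\<^sub>R 1)"
    using assms by (intro pos_scaleR_one) (simp add: cstar_identity power_mono)
  ultimately have "pos ((norm (star z * z) *\<^sub>R 1 - star z * z) + (k\<^sup>2 - norm (star z * z)) *\<^sub>R 1)"
    by (rule pos_add)
  then show ?thesis by (simp add: algebra_simps)
qed

text \<open>Cauchy--Schwarz for a row times a column: with \<open>z\<close> the product and \<open>d\<^sub>i = k\<^sub>i - r\<^sub>i\<^sup>* z\<close>,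
  the element \<open>k\<^sup>2 - z\<^sup>* z\<close> is the sum of the \<open>d\<^sub>i\<^sup>* d\<^sub>i\<close>, the column slack and the
  row slack conjugated by \<open>z\<close>.\<close>

lemma norm_row_column_le:
  fixes r1 r2 r3 k1 k2 k3 :: "'a::unital_cstar_algebra"
  assumes row: "pos (1 - (r1 * star r1 + r2 * star r2 + r3 * star r3))"
    and col: "pos (k\<^sup>2 *\<^sub>R 1 - (star k1 * k1 + star k2 * k2 + star k3 * k3))"
    and k: "0 \<le> k"
  shows "norm (r1 * k1 + r2 * k2 + r3 * k3) \<le> k"
proof -
  define z where "z = r1 * k1 + r2 * k2 + r3 * k3"
  define d where "d r k = k - star r * z" for r k
  define Ro where "Ro = r1 * star r1 + r2 * star r2 + r3 * star r3"
  have sz: "star z = star k1 * star r1 + star k2 * star r2 + star k3 * star r3"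
    unfolding z_def by (simp add: star_simps)
  have d: "star (d r k) * d r k
      = star k * k - (star k * star r) * z - star z * (r * k) + star z * (r * star r) * z" for r k
    unfolding d_def by (simp add: star_simps algebra_simps)
  have e1: "(star k1 * star r1) * z + (star k2 * star r2) * z + (star k3 * star r3) * z = star z * z"
    unfolding sz by (simp add: distrib_right)
  have e2: "star z * (r1 * k1) + star z * (r2 * k2) + star z * (r3 * k3) = star z * z"
    by (subst (4) z_def) (simp add: distrib_left)
  have e3: "star z * (r1 * star r1) * z + star z * (r2 * star r2) * z + star z * (r3 * star r3) * z
      = star z * Ro * z"
    unfolding Ro_def by (simp add: distrib_left distrib_right)
  have e4: "star z * (1 - Ro) * z = star z * z - star z * Ro * z"
    by (simp add: algebra_simps)
  have "star (d r1 k1) * d r1 k1 + star (d r2 k2) * d r2 k2 + star (d r3 k3) * d r3 k3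
      = (star k1 * k1 + star k2 * k2 + star k3 * k3)
        - ((star k1 * star r1) * z + (star k2 * star r2) * z + (star k3 * star r3) * z)
        - (star z * (r1 * k1) + star z * (r2 * k2) + star z * (r3 * k3))
        + (star z * (r1 * star r1) * z + star z * (r2 * star r2) * z + star z * (r3 * star r3) * z)"
    unfolding d by simp
  then have eq: "star (d r1 k1) * d r1 k1 + star (d r2 k2) * d r2 k2 + star (d r3 k3) * d r3 k3
      + (k\<^sup>2 *\<^sub>R 1 - (star k1 * k1 + star k2 * k2 + star k3 * k3)) + star z * (1 - Ro) * z
      = k\<^sup>2 *\<^sub>R 1 - star z * z"
    unfolding e1 e2 e3 e4 by simp
  have "pos (star (d r1 k1) * d r1 k1 + star (d r2 k2) * d r2 k2 + star (d r3 k3) * d r3 k3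
      + (k\<^sup>2 *\<^sub>R 1 - (star k1 * k1 + star k2 * k2 + star k3 * k3)) + star z * (1 - Ro) * z)"
    using row[folded Ro_def] by (intro pos_add pos_star_mult col pos_conj)
  then show ?thesis
    unfolding eq z_def[symmetric] using k by (rule norm_le_of_pos_star)
qed

section \<open>Inverses near the unit\<close>

lemma neumann_inverse:
  fixes a :: "'a::{real_normed_algebra_1,banach}"
  assumes "norm a < 1"
  obtains N where "N * (1 - a) = 1" "(1 - a) * N = 1" "norm N \<le> 1 / (1 - norm a)"
proof -
  define N where "N = (\<Sum>n. a ^ n)"
  have s: "summable (\<lambda>n. a ^ n)"
    by (rule complete_algebra_summable_geometric[OF assms])
  have "N = (\<Sum>n. a ^ Suc n) + 1"
    unfolding N_def using suminf_split_head[OF s] by simp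
  moreover have "(\<Sum>n. a ^ Suc n) = a * N" "(\<Sum>n. a ^ Suc n) = N * a"
    unfolding N_def using suminf_mult[OF s, of a] suminf_mult2[OF s, of a]
    by (simp_all only: power_Suc2[symmetric] power_Suc[symmetric])
  ultimately have N: "N = a * N + 1" "N = N * a + 1" by simp_all
  have "norm N \<le> norm (a * N) + norm (1::'a)"
    using N(1) norm_triangle_ineq by metis
  also have "\<dots> \<le> norm a * norm N + 1"
    using norm_mult_ineq[of a N] by simp
  finally have "norm N \<le> 1 / (1 - norm a)"
    using assms by (simp add: field_simps)
  moreover have "N * (1 - a) = 1" "(1 - a) * N = 1"
    using N by (simp_all add: algebra_simps)
  ultimately show thesis by (rule that[rotated 2])
qed

lemma inverse_commute:
  fixes x :: "'a::monoid_mult"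
  assumes "N * u = 1" "u * N = 1" "x * u = u * x"
  shows "x * N = N * x"
proof -
  have "x * N = N * u * x * N" by (simp add: assms(1))
  also have "\<dots> = N * x * (u * N)" by (simp add: assms(3) mult.assoc[symmetric]) (simp add: assms(3) mult.assoc)
  finally show ?thesis by (simp add: assms(2))
qed

lemma star_inverse:
  fixes u :: "'a::unital_cstar_algebra"
  assumes "N * u = 1" "u * N = 1" "star u = u"
  shows "star N = N"
proof -
  have "star N * u = 1" using assms star_mult[of u N] by (simp add: star_one)
  then have "star N * (u * N) = N" by (simp add: mult.assoc[symmetric])
  then show ?thesis by (simp add: assms(2))
qed

text \<open>Taking \<open>E\<close> as the root times the inverse of its square makes
  \<open>E * E\<close> equal to that inverse, so the Neumann bound applies to \<open>E * E\<close>
  directly.\<close>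

lemma root1m_inverse:
  fixes b :: "'a::unital_cstar_algebra"
  assumes "norm b \<le> l" "l < 1" "star b = b"
  obtains E where "star E = E" "E * root1m b = 1" "root1m b * E = 1" "norm (E * E) \<le> 1 / (1 - l)"
proof -
  let ?P = "root1m b"
  have nb: "norm b \<le> 1" "norm b < 1" using assms by simp_all
  have P: "?P * ?P = 1 - b" "star ?P = ?P" "b * ?P = ?P * b"
    using root1m_square star_root1m root1m_commute nb assms(3) by blast+
  obtain N where N: "N * (1 - b) = 1" "(1 - b) * N = 1" "norm N \<le> 1 / (1 - norm b)"
    by (rule neumann_inverse[OF nb(2)])
  have sN: "star N = N"
    using star_inverse[OF N(1,2)] assms(3) by (simp add: star_simps star_one)
  have PN: "?P * N = N * ?P"
    using inverse_commute[OF N(1,2), of ?P] P(3) by (simp add: algebra_simps)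
  define E where "E = ?P * N"
  have "star E = E" unfolding E_def by (simp add: star_mult sN P(2) PN)
  moreover have "?P * E = 1" unfolding E_def using N(2) P(1) by (simp add: mult.assoc[symmetric])
  moreover have "E * ?P = 1" unfolding E_def PN using N(1) P(1) by (simp add: mult.assoc)
  moreover have "norm (E * E) \<le> 1 / (1 - l)"
  proof -
    have "E * E = (N * ?P) * E" by (simp only: E_def PN)
    then have "E * E = N" using \<open>?P * E = 1\<close> by (simp add: mult.assoc)
    then show ?thesis using N(3) assms(1,2) by (smt (verit) frac_le)
  qed
  ultimately show thesis by (intro that)
qed

section \<open>Partitions of the unit and the corner quotient\<close>

locale partition_pair =
  fixes c s :: "'a::unital_cstar_algebra"
  assumes sa: "star c = c" "star s = s" and comm: "c * s = s * c" and part: "c * c + s * s = 1"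
begin

lemma norm_c: "norm c \<le> 1" and norm_s: "norm s \<le> 1"
proof -
  have "1 - star c * c = star s * s" "1 - star s * s = star c * c"
    using part by (simp_all add: sa algebra_simps)
  then have "pos (1\<^sup>2 *\<^sub>R 1 - star c * c)" "pos (1\<^sup>2 *\<^sub>R 1 - star s * s)"
    by (simp_all add: pos_star_mult)
  then show "norm c \<le> 1" "norm s \<le> 1"
    by (intro norm_le_of_pos_star; simp)+
qed

text \<open>The matrix with rows \<open>(c, s)\<close> and \<open>(s, - c)\<close> is a self-adjoint
  unitary; it acts here on the column \<open>(u, v)\<close>.\<close>

lemma rotate_sum:
  "star (c * u + s * v) * (c * u + s * v) + star (s * u - c * v) * (s * u - c * v) = star u * u + star v * v"
proof -
  have cs: "c * (s * v) = s * (c * v)" for v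
    by (simp only: mult.assoc[symmetric] comm)
  have split: "star u * u = star u * (c * (c * u)) + star u * (s * (s * u))" for u
  proof -
    have "star u * u = star u * (c * c + s * s) * u" by (simp add: part)
    then show ?thesis by (simp only: distrib_left distrib_right mult.assoc)
  qed
  show ?thesis
    unfolding split[of u] split[of v] by (simp add: star_simps sa algebra_simps cs)
qed

lemma decompose: "x = c * (c * x * c) * c + c * (c * x * s) * s + s * (s * x * c) * c + s * (s * x * s) * s"
proof -
  have "x = (c * c + s * s) * x * (c * c + s * s)" by (simp add: part)
  then show ?thesis by (simp add: algebra_simps)
qed

end

context partition_pair
begin

text \<open>Parrott's parametrisation, in the isometric image \<open>[c, s]\<^sup>* x [c, s]\<close> of \<open>x\<close> whose entries are
  \<open>A\<close>, \<open>B\<close>, \<open>C\<close> and the almost vanishing \<open>s x s\<close>.  The element \<open>S\<close> below is the square of the row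
  \<open>[A F, B]\<close>; contractivity of \<open>x\<close> gives \<open>S\<^sup>2 \<le> S\<close> up to an error.\<close>

lemma norm_corner_quotient:
  fixes x A B C P Q E F :: 'a and \<tau> G :: real
  defines "A \<equiv> c * x * c" and "B \<equiv> c * x * s" and "C \<equiv> s * x * c"
  assumes x: "norm x \<le> 1" and tau: "norm (s * x * s) \<le> \<tau>"
    and saPQ: "star P = P" "star Q = Q" "star E = E" "star F = F"
    and P: "P * P = 1 - B * star B" and Q: "Q * Q = 1 - star C * C"
    and E: "E * P = 1" and F: "F * Q = 1" "Q * F = 1"
    and G: "norm (E * E) \<le> G" "norm (F * F) \<le> G"
  shows "(norm (E * A * F))\<^sup>2 \<le> 1 + (2 * G * \<tau> + \<tau>\<^sup>2) * G"
proof -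
  define H where "H = F * F"
  define S where "S = A * H * star A + B * star B"
  \<comment> \<open>The column with entries \<open>H * star A\<close> and \<open>star B\<close>,
    pulled back along \<open>[c, s]\<close>. Applying \<open>x\<close> and then
    \<open>[c, s]\<close> to it gives the column with entries \<open>S\<close> and
    \<open>v + w\<close>; the part \<open>w\<close> comes from the small corner.\<close>
  define m where "m = c * (H * star A) + s * star B"
  define v where "v = C * H * star A"
  define w where "w = (s * x * s) * star B"
  define e where "e = star v * w + star w * v + star w * w"
  define err where "err = 2 * G * \<tau> + \<tau>\<^sup>2"
  have G0: "0 \<le> G" using G(1) norm_ge_zero order_trans by blast
  have tau0: "0 \<le> \<tau>" using tau norm_ge_zero order_trans by blast
  have err0: "0 \<le> err" unfolding err_def using G0 tau0 by simp
  have sH: "star H = H" unfolding H_def by (simp add: star_mult saPQ)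
  have HQ: "H * (Q * Q) = 1"
    unfolding H_def using F by (metis mult.assoc mult_1_right)
  have sS: "star S = S" unfolding S_def by (simp add: star_simps sH mult.assoc)
  have cxm: "c * x * m = S"
    unfolding m_def S_def A_def B_def by (simp add: algebra_simps)
  have sxm: "s * x * m = v + w"
    unfolding m_def v_def w_def C_def by (simp add: algebra_simps)
  have nx: "norm (c * x) \<le> 1" "norm (s * x) \<le> 1"
    using norm_mult_ineq[of c x] norm_mult_ineq[of s x] norm_c norm_s x
    by (meson mult_le_one norm_ge_zero order_trans)+
  have nABC: "norm A \<le> 1" "norm B \<le> 1" "norm C \<le> 1"
    unfolding A_def B_def C_def using nx norm_c norm_s
    by (meson mult_le_one norm_ge_zero norm_mult_ineq order_trans)+
  have nv: "norm v \<le> G"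
  proof -
    have "norm v \<le> norm (C * H) * norm (star A)" unfolding v_def by (rule norm_mult_ineq)
    also have "\<dots> \<le> norm (C * H)" using nABC by (simp add: norm_star mult_left_le)
    also have "\<dots> \<le> norm C * norm H" by (rule norm_mult_ineq)
    also have "\<dots> \<le> norm H" using nABC by (simp add: mult_left_le_one_le)
    finally show ?thesis using G(2) unfolding H_def by simp
  qed
  have nw: "norm w \<le> \<tau>"
  proof -
    have "norm w \<le> norm (s * x * s) * norm (star B)" unfolding w_def by (rule norm_mult_ineq)
    also have "\<dots> \<le> norm (s * x * s)" using nABC by (simp add: norm_star mult_left_le)
    finally show ?thesis using tau by simp
  qed
  have ne: "norm e \<le> err"
  proof -
    have "norm (star v * w) \<le> G * \<tau>" "norm (star w * v) \<le> \<tau> * G" "norm (star w * w) \<le> \<tau> * \<tau>"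
      using nv nw G0 tau0 by (auto intro!: order_trans[OF norm_mult_ineq] mult_mono simp: norm_star)
    then have "norm e \<le> G * \<tau> + \<tau> * G + \<tau> * \<tau>"
      unfolding e_def by (intro norm_triangle_mono)
    then show ?thesis unfolding err_def by (simp add: power2_eq_square algebra_simps)
  qed
  have se: "star e = e" unfolding e_def by (simp add: star_simps)
  have pe: "pos (err *\<^sub>R 1 + e)"
  proof -
    have "pos ((norm (- e) *\<^sub>R 1 - (- e)) + (err - norm e) *\<^sub>R 1)"
      using ne se by (intro pos_add pos_norm_diff pos_scaleR_one) (simp_all add: star_minus)
    then show ?thesis by (simp add: algebra_simps)
  qed
  \<comment> \<open>The estimate \<open>S * S \<le> S + err\<close> has three ingredients:
    \<open>x\<close> is a contraction on \<open>m\<close> (\<open>i\<close> and \<open>ii\<close>),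
    the pull-back does not increase the square of a column (\<open>iii\<close>), and
    \<open>star v * v\<close> is explicit since \<open>H\<close> inverts
    \<open>1 - star C * C\<close> (\<open>iv\<close>). In the sum the terms with
    \<open>A * H * H * star A\<close> cancel.\<close>
  have i: "pos (star m * m - star m * (star x * x) * m)"
    using pos_conj[OF pos_of_norm_le[OF x], of m] by (simp add: algebra_simps)
  have ii: "star m * (star x * x) * m = S * S + star (v + w) * (v + w)"
  proof -
    have "star m * (star x * x) * m = star m * star x * (c * c + s * s) * x * m"
      by (simp add: part mult.assoc)
    also have "\<dots> = star (c * x * m) * (c * x * m) + star (s * x * m) * (s * x * m)"
      by (simp add: star_mult sa algebra_simps)
    finally show ?thesis unfolding cxm sxm sS .
  qed
  have iii: "pos (A * H * H * star A + B * star B - star m * m)"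
  proof -
    have "star (s * (H * star A) - c * star B) * (s * (H * star A) - c * star B)
        = A * H * H * star A + B * star B - star m * m"
      using rotate_sum[of "H * star A" "star B"] unfolding m_def[symmetric]
      by (simp add: star_simps sH mult.assoc) (simp add: algebra_simps)
    then show ?thesis by (metis pos_star_mult)
  qed
  have iv: "star v * v = A * H * H * star A - A * H * star A"
  proof -
    have "star v * v = A * H * (star C * C) * H * star A"
      unfolding v_def by (simp add: star_simps sH mult.assoc)
    also have "star C * C = 1 - Q * Q" unfolding Q by simp
    also have "A * H * (1 - Q * Q) * H * star A = A * H * H * star A - A * (H * (Q * Q)) * H * star A"
      by (simp add: algebra_simps)
    finally show ?thesis unfolding HQ by simp
  qed
  have vw: "star (v + w) * (v + w) = star v * v + e"
    unfolding e_def by (simp add: star_add algebra_simps)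
  have "pos ((star m * m - star m * (star x * x) * m)
      + (A * H * H * star A + B * star B - star m * m) + (err *\<^sub>R 1 + e))"
    by (intro pos_add i iii pe)
  moreover have "(star m * m - star m * (star x * x) * m)
      + (A * H * H * star A + B * star B - star m * m) + (err *\<^sub>R 1 + e)
      = (S + err *\<^sub>R 1) - S * S"
    unfolding ii vw iv S_def by simp
  ultimately have "pos ((S + err *\<^sub>R 1) - S * S)" by (simp only:)
  then have "norm (S * S) \<le> norm (S + err *\<^sub>R 1)"
    by (rule pos_norm_mono[OF pos_square[OF sS]])
  then have "(norm S)\<^sup>2 \<le> norm S + err"
    using norm_triangle_ineq[of S "err *\<^sub>R 1"] cstar_identity[of S] err0 by (simp add: sS)
  have nS: "norm S \<le> 1 + err"
  proof (rule ccontr)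
    assume "\<not> norm S \<le> 1 + err"
    then have g: "norm S > 1 + err" by simp
    then have "norm S * (norm S - 1) > norm S * err"
      using err0 by (intro mult_strict_left_mono) auto
    moreover have "norm S * err \<ge> err" using g err0 by (simp add: mult_right_mono[of 1 "norm S" err, simplified])
    ultimately show False
      using \<open>(norm S)\<^sup>2 \<le> norm S + err\<close> by (simp add: power2_eq_square algebra_simps)
  qed
  have PE: "P * E = 1"
    using arg_cong[OF E, of star] by (simp add: star_mult saPQ star_one)
  have pS: "pos ((1 + err) *\<^sub>R 1 - S)"
  proof -
    have "pos ((norm S *\<^sub>R 1 - S) + (1 + err - norm S) *\<^sub>R 1)"
      using nS sS by (intro pos_add pos_norm_diff pos_scaleR_one) simp_all
    then show ?thesis by (simp add: algebra_simps)
  qed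
  \<comment> \<open>As \<open>A * H * star A\<close> is \<open>S - 1 + P * P\<close>, conjugation by
    the inverse \<open>E\<close> of \<open>P\<close> turns the upper bound on \<open>S\<close> into
    one on \<open>K K\<^sup>*\<close> for the quotient \<open>K = E * A * F\<close>.\<close>
  have KK: "(E * A * F) * star (E * A * F) = E * S * E - E * E + 1"
  proof -
    have "(E * A * F) * star (E * A * F) = E * (A * H * star A) * E"
      unfolding H_def by (simp add: star_mult saPQ mult.assoc)
    also have "A * H * star A = S - 1 + P * P" unfolding S_def P by simp
    also have "E * (S - 1 + P * P) * E = E * S * E - E * E + (E * P) * (P * E)"
      by (simp add: algebra_simps)
    finally show ?thesis unfolding E PE by simp
  qed
  have "star E * ((1 + err) *\<^sub>R 1 - S) * E = (1 + err *\<^sub>R (E * E)) - (E * A * F) * star (E * A * F)"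
    unfolding KK by (simp add: saPQ algebra_simps)
  then have "norm ((E * A * F) * star (E * A * F)) \<le> norm (1 + err *\<^sub>R (E * E))"
    using pos_conj[OF pS, of E] by (intro pos_norm_mono pos_mult_star) simp
  also have "\<dots> \<le> 1 + err * norm (E * E)"
    using norm_triangle_ineq[of 1 "err *\<^sub>R (E * E)"] err0 by simp
  also have "\<dots> \<le> 1 + err * G" using G(1) err0 by (simp add: mult_left_mono)
  finally show ?thesis unfolding norm_mult_star err_def .
qed

end

section \<open>Replacing the corner\<close>

lemma norm_mult_le:
  fixes u v :: "'a::real_normed_algebra"
  assumes "norm u \<le> p" "norm v \<le> q"
  shows "norm (u * v) \<le> p * q"
  using assms by (meson mult_mono' norm_ge_zero norm_mult_ineq order_trans)

lemma norm_root1m_le: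
  fixes b :: "'a::unital_cstar_algebra"
  assumes "norm b \<le> 1" "star b = b" "pos b"
  shows "norm (root1m b) \<le> 1"
  by (rule norm_le_of_pos_star)
     (use root1m_square[OF assms(1,2)] star_root1m[OF assms(1,2)] assms(3) in simp_all)

lemma norm_root1m_scale_diff:
  fixes b :: "'a::unital_cstar_algebra"
  assumes "norm b \<le> 1" "0 \<le> l" "l \<le> 1"
  shows "norm (root1m (l *\<^sub>R b) - root1m b) \<le> sqrt (1 - l)"
  unfolding root1m_def using norm_root_defect_scale_diff[OF assms] by simp

context partition_pair
begin

text \<open>The quotient \<open>K\<close> is formed at level \<open>R\<close>, where its
  denominators are invertible, and put back at level \<open>\<beta>\<close>. The factor
  \<open>\<kappa>\<close> absorbs the failure of \<open>K\<close> to be an exact contraction, and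
  \<open>G\<close> bounds the squares of the inverse roots.\<close>

lemma corner_correction:
  fixes x :: 'a
  assumes x: "norm x \<le> R" and xs: "norm (x * s) \<le> \<beta>" and sx: "norm (s * x) \<le> \<beta>"
    and sxs: "norm (s * x * s) \<le> \<tau>" and beta: "0 < \<beta>" "\<beta> < R"
    and kappa: "1 \<le> \<kappa>" "1 + (2 * G * (\<tau> / R) + (\<tau> / R)\<^sup>2) * G \<le> \<kappa>\<^sup>2"
    and G: "G = 1 / (1 - (\<beta> / R)\<^sup>2)"
  obtains w where "norm w \<le> \<kappa> * (R - \<beta> + 2 * \<beta> * sqrt (1 - (\<beta> / R)\<^sup>2))"
    "norm (x - c * w * c) \<le> \<beta> * \<kappa> + \<tau>"
proof -
  have R: "0 < R" using beta by simp
  define l where "l = (\<beta> / R)\<^sup>2"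
  have l: "0 \<le> l" "l < 1"
    unfolding l_def using beta R by (simp_all add: power_less_one_iff)
  define A where "A = c * x * c"
  define B where "B = c * x * s"
  define C where "C = s * x * c"
  \<comment> \<open>Both \<open>b\<close> and \<open>f\<close> are normalised at level
    \<open>\<beta>\<close>; multiplication by \<open>l\<close> changes them to the corresponding
    elements at level \<open>R\<close>.\<close>
  define b where "b = (1 / \<beta>\<^sup>2) *\<^sub>R (B * star B)"
  define f where "f = (1 / \<beta>\<^sup>2) *\<^sub>R (star C * C)"
  have nB: "norm B \<le> \<beta>"
  proof -
    have "norm (c * (x * s)) \<le> 1 * \<beta>"
      by (rule norm_mult_le[OF norm_c xs])
    then show ?thesis by (simp add: B_def mult.assoc)
  qed
  have nC: "norm C \<le> \<beta>"
  proof -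
    have "norm (s * x * c) \<le> \<beta> * 1"
      by (rule norm_mult_le[OF sx norm_c])
    then show ?thesis by (simp add: C_def)
  qed
  have b: "norm b \<le> 1" "star b = b" "pos b"
    unfolding b_def using nB beta
    by (auto simp: norm_mult_star star_simps power_mono intro: pos_scaleR pos_mult_star)
  have f: "norm f \<le> 1" "star f = f" "pos f"
    unfolding f_def using nC beta
    by (auto simp: cstar_identity star_simps power_mono intro: pos_scaleR pos_star_mult)
  have lb: "norm (l *\<^sub>R b) \<le> l" "star (l *\<^sub>R b) = l *\<^sub>R b" "pos (l *\<^sub>R b)"
    using b l by (auto simp: star_scaleR mult_left_le intro: pos_scaleR)
  have lf: "norm (l *\<^sub>R f) \<le> l" "star (l *\<^sub>R f) = l *\<^sub>R f" "pos (l *\<^sub>R f)"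
    using f l by (auto simp: star_scaleR mult_left_le intro: pos_scaleR)
  have lb1: "norm (l *\<^sub>R b) \<le> 1" and lf1: "norm (l *\<^sub>R f) \<le> 1" using lb(1) lf(1) l by simp_all
  define P where "P = root1m (l *\<^sub>R b)"
  define Q where "Q = root1m (l *\<^sub>R f)"
  define P' where "P' = root1m b"
  define Q' where "Q' = root1m f"
  obtain E where E: "star E = E" "E * P = 1" "P * E = 1" "norm (E * E) \<le> 1 / (1 - l)"
    unfolding P_def by (rule root1m_inverse[OF lb(1) l(2) lb(2)])
  obtain F where F: "star F = F" "F * Q = 1" "Q * F = 1" "norm (F * F) \<le> 1 / (1 - l)"
    unfolding Q_def by (rule root1m_inverse[OF lf(1) l(2) lf(2)])
  define y where "y = (1 / R) *\<^sub>R x"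
  define K where "K = E * (c * y * c) * F"
  have y: "norm y \<le> 1" "norm (s * y * s) \<le> \<tau> / R"
    unfolding y_def using x sxs R by (simp_all add: divide_right_mono)
  have lb_eq: "l *\<^sub>R b = (c * y * s) * star (c * y * s)"
    unfolding l_def b_def y_def B_def using beta R
    by (simp add: star_simps power2_eq_square)
  have lf_eq: "l *\<^sub>R f = star (s * y * c) * (s * y * c)"
    unfolding l_def f_def y_def C_def using beta R
    by (simp add: star_simps power2_eq_square)
  have "(norm K)\<^sup>2 \<le> 1 + (2 * G * (\<tau> / R) + (\<tau> / R)\<^sup>2) * G"
    unfolding K_def
  proof (rule norm_corner_quotient[OF y, where P = P and Q = Q])
    show "star P = P" "star Q = Q"
      unfolding P_def Q_def using star_root1m lb lf lb1 lf1 by blast+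
    show "P * P = 1 - (c * y * s) * star (c * y * s)"
      unfolding P_def lb_eq[symmetric] using root1m_square[OF lb1 lb(2)] .
    show "Q * Q = 1 - star (s * y * c) * (s * y * c)"
      unfolding Q_def lf_eq[symmetric] using root1m_square[OF lf1 lf(2)] .
  qed (use E F G in \<open>simp_all add: l_def\<close>)
  from order_trans[OF this kappa(2)] kappa(1) have nK: "norm K \<le> \<kappa>"
    by (intro power2_le_imp_le[of "norm K"]) simp_all
  have A: "A = R *\<^sub>R (P * K * Q)"
  proof -
    have "P * K * Q = (P * E) * (c * y * c) * (F * Q)"
      unfolding K_def by (simp add: mult.assoc)
    then show ?thesis
      unfolding E(3) F(2) using R by (simp add: y_def A_def)
  qed
  define M where "M = \<beta> *\<^sub>R (P' * K * Q')"
  have nP: "norm P \<le> 1" "norm Q \<le> 1" "norm P' \<le> 1" "norm Q' \<le> 1"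
    unfolding P_def Q_def P'_def Q'_def
    using norm_root1m_le b f lb(2,3) lf(2,3) lb1 lf1 by blast+
  have diff: "norm (P - P') \<le> sqrt (1 - l)" "norm (Q - Q') \<le> sqrt (1 - l)"
    unfolding P_def Q_def P'_def Q'_def
    by (rule norm_root1m_scale_diff[OF b(1) l(1) less_imp_le[OF l(2)]]
        norm_root1m_scale_diff[OF f(1) l(1) less_imp_le[OF l(2)]])+
  define w where "w = A - M"
  \<comment> \<open>Moving from \<open>R P K Q\<close> to \<open>\<beta> P' K Q'\<close> changes one
    factor at a time: the level, the left root, the right root.\<close>
  have w_eq: "w = (R - \<beta>) *\<^sub>R (P * K * Q) + \<beta> *\<^sub>R ((P - P') * K * Q) + \<beta> *\<^sub>R (P' * K * (Q - Q'))"
    unfolding w_def A M_def by (simp add: algebra_simps)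
  have "norm w \<le> (R - \<beta>) * (1 * \<kappa> * 1) + \<beta> * (sqrt (1 - l) * \<kappa> * 1) + \<beta> * (1 * \<kappa> * sqrt (1 - l))"
    unfolding w_eq
  proof (intro norm_triangle_mono)
    have "norm (P * K * Q) \<le> 1 * \<kappa> * 1" "norm ((P - P') * K * Q) \<le> sqrt (1 - l) * \<kappa> * 1"
      "norm (P' * K * (Q - Q')) \<le> 1 * \<kappa> * sqrt (1 - l)"
      by (intro norm_mult_le nP nK diff)+
    then show "norm ((R - \<beta>) *\<^sub>R (P * K * Q)) \<le> (R - \<beta>) * (1 * \<kappa> * 1)"
      "norm (\<beta> *\<^sub>R ((P - P') * K * Q)) \<le> \<beta> * (sqrt (1 - l) * \<kappa> * 1)"
      "norm (\<beta> *\<^sub>R (P' * K * (Q - Q'))) \<le> \<beta> * (1 * \<kappa> * sqrt (1 - l))"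
      using beta by simp_all
  qed
  then have nw: "norm w \<le> \<kappa> * (R - \<beta> + 2 * \<beta> * sqrt (1 - l))"
    by (simp add: algebra_simps)
  \<comment> \<open>The new matrix divided by \<open>\<beta>\<close>, with its fourth corner set to
    zero, is factored as the row \<open>[c P', c B / \<beta>, s]\<close> times the column
    \<open>[K Q' c, s, C c / \<beta>]\<close>.\<close>
  define z where "z = (c * P') * (K * Q' * c) + (c * ((1 / \<beta>) *\<^sub>R B)) * s + s * (((1 / \<beta>) *\<^sub>R C) * c)"
  have P'2: "P' * P' = 1 - b" "star P' = P'" and Q'2: "Q' * Q' = 1 - f" "star Q' = Q'"
    unfolding P'_def Q'_def using root1m_square star_root1m b f by blast+
  have "norm z \<le> \<kappa>"
    unfolding z_def
  proof (rule norm_row_column_le)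
    have "c * P' * star (c * P') = c * (P' * P') * c"
      by (simp add: star_mult sa P'2(2) mult.assoc)
    moreover have "c * ((1 / \<beta>) *\<^sub>R B) * star (c * ((1 / \<beta>) *\<^sub>R B)) = c * b * c"
      unfolding b_def by (simp add: star_simps sa power2_eq_square mult.assoc)
    ultimately have "c * P' * star (c * P') + c * ((1 / \<beta>) *\<^sub>R B) * star (c * ((1 / \<beta>) *\<^sub>R B)) + s * star s
        = c * (1 - b) * c + c * b * c + s * s"
      using P'2 by (simp add: sa)
    also have "\<dots> = 1" using part by (simp add: algebra_simps)
    finally show "pos (1 - (c * P' * star (c * P') + c * ((1 / \<beta>) *\<^sub>R B) * star (c * ((1 / \<beta>) *\<^sub>R B)) + s * star s))"
      by (simp add: pos_zero)
  next
    \<comment> \<open>Writing \<open>\<kappa>\<^sup>2\<close> as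
      \<open>\<kappa>\<^sup>2 (c\<^sup>2 + s\<^sup>2)\<close> splits the column slack into a
      compression of \<open>T\<close> and a multiple \<open>\<kappa>\<^sup>2 - 1\<close> of positive
      terms.\<close>
    define T where "T = Q' * (\<kappa>\<^sup>2 *\<^sub>R 1 - star K * K) * Q'"
    have T: "T = \<kappa>\<^sup>2 *\<^sub>R (1 - f) - Q' * star K * K * Q'"
      unfolding T_def Q'2(1)[symmetric] by (simp add: algebra_simps)
    have "star (K * Q' * c) * (K * Q' * c) = c * (Q' * star K * K * Q') * c"
      by (simp add: star_mult sa Q'2(2) mult.assoc)
    moreover have "star ((1 / \<beta>) *\<^sub>R C * c) * ((1 / \<beta>) *\<^sub>R C * c) = c * f * c"
      unfolding f_def by (simp add: star_simps sa power2_eq_square mult.assoc)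
    ultimately have "\<kappa>\<^sup>2 *\<^sub>R 1 - (star (K * Q' * c) * (K * Q' * c) + star s * s
          + star ((1 / \<beta>) *\<^sub>R C * c) * ((1 / \<beta>) *\<^sub>R C * c))
        = \<kappa>\<^sup>2 *\<^sub>R (c * c + s * s) - (c * (Q' * star K * K * Q') * c + s * s + c * f * c)"
      by (simp add: sa part)
    also have "\<dots> = star c * T * c + (\<kappa>\<^sup>2 - 1) *\<^sub>R (star c * f * c + star s * s)"
      unfolding T by (simp add: sa algebra_simps)
    finally have eq: "\<kappa>\<^sup>2 *\<^sub>R 1 - (star (K * Q' * c) * (K * Q' * c) + star s * s
          + star ((1 / \<beta>) *\<^sub>R C * c) * ((1 / \<beta>) *\<^sub>R C * c)) = \<dots>" .
    have "pos T"
      unfolding T_def using pos_conj[OF pos_of_norm_le[OF nK], of Q'] Q'2(2) by simp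
    then show "pos (\<kappa>\<^sup>2 *\<^sub>R 1 - (star (K * Q' * c) * (K * Q' * c) + star s * s
          + star ((1 / \<beta>) *\<^sub>R C * c) * ((1 / \<beta>) *\<^sub>R C * c)))"
      unfolding eq using kappa(1) f(3)
      by (intro pos_add pos_conj pos_scaleR pos_star_mult) simp_all
  qed (use kappa in simp)
  moreover have "x - c * w * c = \<beta> *\<^sub>R z + s * (s * x * s) * s"
  proof -
    have bz: "\<beta> *\<^sub>R z = c * M * c + c * B * s + s * C * c"
      unfolding z_def M_def using beta by (simp add: algebra_simps)
    have dx: "x = c * A * c + c * B * s + s * C * c + s * (s * x * s) * s"
      unfolding A_def B_def C_def by (rule decompose)
    have cw: "c * w * c = c * A * c - c * M * c"
      unfolding w_def by (simp add: algebra_simps)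
    have "x' - w' = m + q + r + t" if "x' = p + q + r + t" "w' = p - m" for x' w' m p q r t :: 'a
      using that by simp
    from this[OF dx cw] show ?thesis unfolding bz .
  qed
  moreover have "norm (s * (s * x * s) * s) \<le> 1 * \<tau> * 1"
    by (intro norm_mult_le norm_s sxs)
  moreover have "norm (\<beta> *\<^sub>R z) \<le> \<beta> * \<kappa>"
    using \<open>norm z \<le> \<kappa>\<close> beta by simp
  ultimately have "norm (x - c * w * c) \<le> \<beta> * \<kappa> + \<tau>"
    by (metis mult_1_left mult_1_right norm_triangle_mono)
  then show thesis using nw that unfolding l_def by blast
qed

end

section \<open>Best approximation in a unital algebra\<close>

text \<open>The condition \<open>mult_D\<close> allows any middle factor, the unit included. In this
  form heredity survives the passage to the unitization, and it is what puts the corrections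
  \<open>c * w * c\<close> into \<open>D\<close>.\<close>

locale hereditary_corner =
  fixes D :: "'a::unital_cstar_algebra set"
  assumes subspace_D: "subspace D" and closed_D: "closed D"
    and star_D: "\<And>d. d \<in> D \<Longrightarrow> star d \<in> D"
    and mult_D: "\<And>d u e. d \<in> D \<Longrightarrow> e \<in> D \<Longrightarrow> d * u * e \<in> D"
begin

lemmas D_simps = subspace_0[OF subspace_D] subspace_add[OF subspace_D] subspace_diff[OF subspace_D]
  subspace_scale[OF subspace_D] star_D mult_D

lemma mult2_D: "d \<in> D \<Longrightarrow> e \<in> D \<Longrightarrow> d * e \<in> D"
  using mult_D[of d e 1] by simp

text \<open>Subtracting the scalar iterates for \<open>1\<close> cancels the multiples of the unit,
  so each difference is a polynomial in \<open>1 - w\<close> without constant term. The limit is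
  \<open>root1m w\<close> because \<open>root_defect 1 = 1\<close>.\<close>

lemma root1m_mem:
  assumes "norm w \<le> 1" "1 - w \<in> D"
  shows "root1m w \<in> D"
proof -
  have "root_iter 1 k *\<^sub>R 1 - root_iter w k \<in> D" for k
  proof (induction k)
    case 0
    show ?case by (simp add: D_simps)
  next
    case (Suc k)
    define d where "d = root_iter 1 k *\<^sub>R 1 - root_iter w k"
    have w: "root_iter w k = root_iter 1 k *\<^sub>R 1 - d" by (simp add: d_def)
    have "root_iter 1 (Suc k) *\<^sub>R 1 - root_iter w (Suc k)
        = (1/2) *\<^sub>R ((1 - w) + ((2 * root_iter 1 k) *\<^sub>R d - d * d))"
      unfolding root_iter.simps w by (simp add: algebra_simps scaleR_2[symmetric])
    also have "\<dots> \<in> D"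
      using Suc unfolding d_def[symmetric]
      by (intro subspace_scale[OF subspace_D] subspace_add[OF subspace_D assms(2)]
          subspace_diff[OF subspace_D] mult2_D)
    finally show ?case .
  qed
  moreover have "(\<lambda>k. root_iter 1 k *\<^sub>R 1 - root_iter w k) \<longlonglongrightarrow> root_defect 1 *\<^sub>R 1 - root_defect w"
    using assms(1) by (intro tendsto_intros root_iter_LIMSEQ) simp_all
  ultimately have "root_defect 1 *\<^sub>R 1 - root_defect w \<in> D"
    by (rule closed_sequentially[OF closed_D])
  then show ?thesis by (simp add: root1m_def root_defect_real)
qed

text \<open>Take \<open>s = (1 + n a)\<^sup>-\<^sup>1\<close> for large \<open>n\<close> and \<open>c\<close> the square root of \<open>1 - s\<^sup>2\<close>.\<close>

lemma partition_exists:
  assumes a: "a \<in> D" "pos a" and eps: "0 < \<epsilon>"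
  obtains c s where "partition_pair c s" "c \<in> D" "norm (s * a * s) \<le> \<epsilon>"
proof -
  obtain t where t: "norm (t *\<^sub>R 1 - a) \<le> t"
    using a(2) by (auto simp: pos_def)
  have t0: "0 \<le> t" using t norm_ge_zero order_trans by blast
  \<comment> \<open>The numerator \<open>2\<close> bounds \<open>norm (1 - s)\<close>, and
    \<open>1 - s\<close> will equal \<open>n s a\<close>.\<close>
  obtain n :: nat where n: "2 / \<epsilon> < real n" using reals_Archimedean2 by blast
  have n0: "0 < real n" using n eps by (meson divide_pos_pos less_trans zero_less_numeral)
  \<comment> \<open>Factoring \<open>1 + n a = q (1 - b)\<close> makes the norm condition in
    \<open>pos a\<close> yield \<open>norm b < 1\<close>, so that the Neumann series gives the
    inverse.\<close>
  define q where "q = 1 + n * t"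
  have q: "0 < q" "1 \<le> q" using t0 by (auto simp: q_def add_pos_nonneg)
  define b where "b = (n / q) *\<^sub>R (t *\<^sub>R 1 - a)"
  have nb: "norm b \<le> 1 - 1 / q"
  proof -
    have "norm b \<le> (n / q) * t"
      unfolding b_def using t n0 q by (simp add: divide_right_mono)
    also have "\<dots> = 1 - 1 / q" using q by (simp add: q_def field_simps)
    finally show ?thesis .
  qed
  have nb1: "norm b < 1" using nb q by (smt (verit) divide_pos_pos)
  obtain N where N: "N * (1 - b) = 1" "(1 - b) * N = 1" "norm N \<le> 1 / (1 - norm b)"
    by (rule neumann_inverse[OF nb1])
  define s where "s = (1 / q) *\<^sub>R N"
  have qb: "q *\<^sub>R (1 - b) = 1 + real n *\<^sub>R a"
  proof -
    have "q *\<^sub>R b = real n *\<^sub>R (t *\<^sub>R 1 - a)" unfolding b_def using q by simp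
    then show ?thesis by (simp add: scaleR_diff_right) (simp add: q_def algebra_simps)
  qed
  have "s * (1 + real n *\<^sub>R a) = 1" "(1 + real n *\<^sub>R a) * s = 1"
    unfolding qb[symmetric] s_def using N q by simp_all
  then have na: "real n *\<^sub>R (s * a) = 1 - s" "real n *\<^sub>R (a * s) = 1 - s"
    by (simp_all add: algebra_simps)
  have ns: "norm s \<le> 1"
  proof -
    have "1 / (1 - norm b) \<le> q"
      using nb nb1 q by (simp add: field_simps)
    then show ?thesis unfolding s_def using N(3) q by simp
  qed
  have ss: "star s = s"
  proof -
    have "star (1 - b) = 1 - b"
      using pos_star[OF a(2)] by (simp add: b_def star_simps star_one)
    then show ?thesis unfolding s_def using star_inverse[OF N(1,2)] by (simp add: star_simps)
  qed
  \<comment> \<open>The factor \<open>s\<close> itself need not lie in \<open>D\<close>; one more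
    use of the resolvent identity encloses it between two copies of \<open>a\<close>.\<close>
  have "a * s = a - real n *\<^sub>R (a * s * a)"
  proof -
    have "a * s = a * (1 - real n *\<^sub>R (s * a))" unfolding na(1) by simp
    then show ?thesis by (simp add: algebra_simps)
  qed
  then have "a * s \<in> D" using a(1) D_simps by metis
  then have s1: "1 - s \<in> D" unfolding na(2)[symmetric] by (rule D_simps)
  have nss: "norm (s * s) \<le> 1" using norm_mult_le[OF ns ns] by simp
  have sss: "star (s * s) = s * s" by (simp add: star_mult ss)
  define c where "c = root1m (s * s)"
  have "1 - s * s = 2 *\<^sub>R (1 - s) - (1 - s) * (1 - s)"
    by (simp add: algebra_simps scaleR_2)
  also have "\<dots> \<in> D"
    by (intro subspace_diff[OF subspace_D subspace_scale[OF subspace_D s1] mult2_D[OF s1 s1]])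
  finally have "c \<in> D" unfolding c_def by (rule root1m_mem[OF nss])
  moreover have "partition_pair c s"
  proof
    show "star c = c" "c * c + s * s = 1"
      unfolding c_def using root1m_square[OF nss sss] star_root1m[OF nss sss] by simp_all
    show "c * s = s * c"
      unfolding c_def using root1m_commute[OF nss, of s] by (simp add: mult.assoc)
  qed (rule ss)
  moreover have "norm (s * a * s) \<le> \<epsilon>"
  proof -
    have "norm (real n *\<^sub>R (s * a)) \<le> 1 + 1"
      unfolding na(1) using ns by (intro order_trans[OF norm_triangle_ineq4]) simp
    then have "norm (real n *\<^sub>R (s * a) * s) \<le> 2 * 1"
      using ns by (intro norm_mult_le) simp_all
    then have "real n * norm (s * a * s) \<le> 2" by simp
    also have "2 \<le> real n * \<epsilon>" using n eps by (simp add: field_simps)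
    finally show ?thesis using n0 by simp
  qed
  ultimately show thesis using that by blast
qed

text \<open>The summand \<open>d0\<close> records the corrections already subtracted, which makes
  the step repeatable. The bound on \<open>norm x\<close> keeps the new correction small, while
  \<open>near\<close> controls the off-diagonal corners: \<open>x * s\<close> and
  \<open>(x - d) * s\<close> differ only by the small \<open>d * s\<close>.\<close>

lemma correction_step:
  assumes x: "x = l + star m + d0" and lm: "star l * l \<in> D" "star m * m \<in> D" "d0 \<in> D"
    and delta: "0 < \<delta>" "\<delta> \<le> 1" "norm x \<le> 1 + \<delta>"
    and near: "\<And>\<eta>. 0 < \<eta> \<Longrightarrow> \<exists>d\<in>D. norm (x - d) \<le> 1 + \<eta>"
    and sigma0: "0 < \<sigma>0"
  obtains y where "y \<in> D" "norm y \<le> 6 * sqrt \<delta>" "norm (x - y) \<le> 1 + \<sigma>0"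
proof -
  define \<sigma> where "\<sigma> = min \<sigma>0 \<delta>"
  have sigma: "0 < \<sigma>" "\<sigma> \<le> \<delta>" "\<sigma> \<le> 1" "\<sigma> \<le> \<sigma>0"
    using delta sigma0 by (auto simp: \<sigma>_def)
  \<comment> \<open>The fractions of \<open>\<sigma>\<close> are a budget:
    \<open>\<beta> * \<kappa> + \<tau>\<close> must stay below \<open>1 + \<sigma>\<close>, and
    \<open>\<sigma> \<le> \<delta>\<close> secures the gap \<open>\<beta> < R\<close>.\<close>
  define \<beta> where "\<beta> = 1 + \<sigma> / 4"
  define R where "R = 1 + \<delta>"
  define \<kappa> where "\<kappa> = 1 + \<sigma> / 8"
  define G where "G = 1 / (1 - (\<beta> / R)\<^sup>2)"
  have beta: "0 < \<beta>" "\<beta> < R" "1 \<le> \<beta>" "\<beta> \<le> 5/4"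
    unfolding \<beta>_def R_def using sigma delta by auto
  have R: "1 \<le> R" "0 < R" unfolding R_def using delta by auto
  have kappa: "1 \<le> \<kappa>" "0 < \<kappa>\<^sup>2 - 1" "\<kappa> \<le> 9/8"
    unfolding \<kappa>_def using sigma by (auto simp: power2_eq_square algebra_simps intro: add_pos_pos)
  have "(\<beta> / R)\<^sup>2 < 1" using beta R by (simp add: power_less_one_iff)
  then have G: "0 < G" unfolding G_def by simp
  \<comment> \<open>The choice comes after \<open>G\<close>, which grows without bound as the gap
    closes; the last entry of the minimum keeps the error of the quotient within
    \<open>\<kappa>\<^sup>2 - 1\<close>.\<close>
  define \<tau> where "\<tau> = min (\<sigma> / 4) (min 1 ((\<kappa>\<^sup>2 - 1) / ((2 * G + 1) * G)))"
  have tau: "0 < \<tau>" "\<tau> \<le> \<sigma> / 4" "\<tau> \<le> 1"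
    using sigma kappa G by (simp_all only: \<tau>_def min.cobounded1 min.coboundedI2 min_less_iff_conj) auto
  have "\<tau> * ((2 * G + 1) * G) \<le> \<kappa>\<^sup>2 - 1"
  proof -
    have "\<tau> \<le> (\<kappa>\<^sup>2 - 1) / ((2 * G + 1) * G)" unfolding \<tau>_def by simp
    then show ?thesis using G by (simp add: pos_le_divide_eq)
  qed
  moreover have "(2 * G * (\<tau> / R) + (\<tau> / R)\<^sup>2) * G \<le> \<tau> * ((2 * G + 1) * G)"
  proof -
    have "\<tau> / R \<le> \<tau>" using R tau by (simp add: divide_le_eq)
    then have "2 * G * (\<tau> / R) \<le> 2 * G * \<tau>"
      using G by (intro mult_left_mono) auto
    moreover have "(\<tau> / R)\<^sup>2 \<le> \<tau> * 1"
      using \<open>\<tau> / R \<le> \<tau>\<close> tau R unfolding power2_eq_square by (intro mult_mono) auto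
    ultimately have "(2 * G * (\<tau> / R) + (\<tau> / R)\<^sup>2) * G \<le> (2 * G * \<tau> + \<tau>) * G"
      using G by (intro mult_right_mono) auto
    then show ?thesis by (simp add: algebra_simps)
  qed
  ultimately have kG: "1 + (2 * G * (\<tau> / R) + (\<tau> / R)\<^sup>2) * G \<le> \<kappa>\<^sup>2" by simp
  obtain d where d: "d \<in> D" "norm (x - d) \<le> 1 + \<sigma> / 8"
    using near[of "\<sigma> / 8"] sigma by auto
  \<comment> \<open>A single element above all the squares that \<open>s\<close> has to make small.
    The summand \<open>d * star d\<close> takes care of \<open>s * d\<close>.\<close>
  define a where "a = star l * l + star m * m + star d0 * d0 + star d * d + d * star d"
  have aD: "a \<in> D"
    unfolding a_def using lm d(1) by (simp add: D_simps mult2_D)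
  have pa: "pos a" unfolding a_def by (intro pos_add pos_star_mult pos_mult_star)
  \<comment> \<open>One third of \<open>\<tau>\<close> for each of the three summands of
    \<open>s * x * s\<close>, and the part \<open>\<sigma> / 8\<close> of \<open>\<beta>\<close>
    that \<open>norm (x - d)\<close> leaves free. Norms of \<open>k * s\<close> are read off from
    squares, so \<open>s\<close> is chosen for \<open>\<eta>\<^sup>2\<close>.\<close>
  define \<eta> where "\<eta> = min (\<tau> / 3) (\<sigma> / 8)"
  have eta: "0 < \<eta>" using tau sigma by (simp add: \<eta>_def)
  obtain c s where cs: "partition_pair c s" "c \<in> D" "norm (s * a * s) \<le> \<eta>\<^sup>2"
    using partition_exists[OF aD pa, of "\<eta>\<^sup>2"] eta by (metis zero_less_power)
  interpret partition_pair c s by (rule cs(1))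
  have small: "norm (k * s) \<le> \<eta>" if "pos (a - star k * k)" for k
  proof -
    have "norm (star (k * s) * (k * s)) \<le> norm (s * a * s)"
    proof (rule pos_norm_mono[OF pos_star_mult])
      have "s * a * s - star (k * s) * (k * s) = star s * (a - star k * k) * s"
        by (simp add: star_mult sa algebra_simps)
      then show "pos (s * a * s - star (k * s) * (k * s))"
        using pos_conj[OF that, of s] by simp
    qed
    from order_trans[OF this cs(3)] eta show ?thesis
      unfolding cstar_identity by (intro power2_le_imp_le[of "norm (k * s)"]) simp_all
  qed
  have parts: "pos (star l * l)" "pos (star m * m)" "pos (star d0 * d0)" "pos (star d * d)" "pos (d * star d)"
    by (intro pos_star_mult pos_mult_star)+
  have "a - star l * l = star m * m + star d0 * d0 + star d * d + d * star d"
    "a - star m * m = star l * l + star d0 * d0 + star d * d + d * star d"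
    "a - star d0 * d0 = star l * l + star m * m + star d * d + d * star d"
    "a - star d * d = star l * l + star m * m + star d0 * d0 + d * star d"
    "a - star (star d) * star d = star l * l + star m * m + star d0 * d0 + star d * d"
    unfolding a_def star_star by simp_all
  then have sm: "norm (l * s) \<le> \<eta>" "norm (m * s) \<le> \<eta>" "norm (d0 * s) \<le> \<eta>"
      "norm (d * s) \<le> \<eta>" "norm (star d * s) \<le> \<eta>"
    using parts by (auto intro!: small pos_add)
  have flip: "norm (s * star k) = norm (k * s)" for k
    using norm_star[of "k * s"] by (simp add: star_mult sa)
  have xs: "norm (x * s) \<le> \<beta>"
  proof -
    have "norm ((x - d) * s + d * s) \<le> (1 + \<sigma> / 8) * 1 + \<sigma> / 8"
      using sm(4) by (intro norm_triangle_mono norm_mult_le d norm_s) (simp add: \<eta>_def)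
    then show ?thesis by (simp add: \<beta>_def algebra_simps)
  qed
  have sx: "norm (s * x) \<le> \<beta>"
  proof -
    have "norm (s * (x - d) + s * d) \<le> 1 * (1 + \<sigma> / 8) + \<sigma> / 8"
      using sm(5) flip[of "star d"]
      by (intro norm_triangle_mono norm_mult_le d norm_s) (simp add: \<eta>_def star_star)
    then show ?thesis by (simp add: \<beta>_def algebra_simps)
  qed
  have sxs: "norm (s * x * s) \<le> \<tau>"
  proof -
    have "norm (s * (l * s) + (s * star m) * s + s * (d0 * s)) \<le> 1 * \<eta> + \<eta> * 1 + 1 * \<eta>"
      using sm flip[of m] by (intro norm_triangle_mono norm_mult_le norm_s) simp_all
    also have "\<dots> \<le> \<tau>" by (simp add: \<eta>_def min_def)
    finally show ?thesis unfolding x by (simp add: algebra_simps)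
  qed
  obtain w where w: "norm w \<le> \<kappa> * (R - \<beta> + 2 * \<beta> * sqrt (1 - (\<beta> / R)\<^sup>2))"
      "norm (x - c * w * c) \<le> \<beta> * \<kappa> + \<tau>"
    by (rule corner_correction[OF _ xs sx sxs beta(1,2) kappa(1) kG G_def])
       (use delta(3) R_def in auto)
  have "norm (x - c * w * c) \<le> 1 + \<sigma>0"
  proof -
    have "\<beta> * \<kappa> = 1 + \<sigma> / 4 + \<sigma> / 8 + \<sigma> * \<sigma> / 32"
      by (simp add: \<beta>_def \<kappa>_def algebra_simps)
    moreover have "\<sigma> * \<sigma> \<le> \<sigma>" using sigma by (simp add: mult_left_le)
    ultimately show ?thesis using w(2) tau(2) sigma by linarith
  qed
  moreover have "norm (c * w * c) \<le> 6 * sqrt \<delta>"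
  proof -
    \<comment> \<open>The true bound is \<open>2 * \<delta>\<close>; the perfect square
      \<open>9/4\<close> avoids an irrational factor. Altogether
      \<open>9/8 * 19/4 < 6\<close>.\<close>
    have "1 - (\<beta> / R)\<^sup>2 \<le> (3/2)\<^sup>2 * \<delta>"
    proof -
      have "1 - \<delta> \<le> 1 / R" using R delta by (simp add: R_def field_simps)
      also have "\<dots> \<le> \<beta> / R" using beta R by (simp add: divide_right_mono)
      finally have "(1 - \<delta>)\<^sup>2 \<le> (\<beta> / R)\<^sup>2" using delta by (intro power_mono) auto
      moreover have "1 - 2 * \<delta> \<le> (1 - \<delta>)\<^sup>2" by (simp add: power2_eq_square algebra_simps)
      moreover have "(3/2)\<^sup>2 * \<delta> = 9/4 * \<delta>" by (simp add: power2_eq_square)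
      ultimately show ?thesis using delta by linarith
    qed
    then have r: "sqrt (1 - (\<beta> / R)\<^sup>2) \<le> 3/2 * sqrt \<delta>"
      using real_sqrt_le_mono by (fastforce simp: real_sqrt_mult)
    have "\<delta> \<le> sqrt \<delta>" using delta by (simp add: real_le_rsqrt power2_eq_square mult_left_le)
    then have "R - \<beta> \<le> sqrt \<delta>" using beta(3) by (simp add: R_def)
    moreover have "2 * \<beta> * sqrt (1 - (\<beta> / R)\<^sup>2) \<le> 2 * (5/4) * (3/2 * sqrt \<delta>)"
      using beta r \<open>(\<beta> / R)\<^sup>2 < 1\<close> by (intro mult_mono) auto
    ultimately have "R - \<beta> + 2 * \<beta> * sqrt (1 - (\<beta> / R)\<^sup>2) \<le> 19/4 * sqrt \<delta>" by simp
    then have "norm w \<le> 9/8 * (19/4 * sqrt \<delta>)"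
      using w(1) kappa beta \<open>(\<beta> / R)\<^sup>2 < 1\<close>
      by (elim order_trans) (intro mult_mono, auto intro!: add_nonneg_nonneg)
    moreover have "norm (c * w * c) \<le> 1 * norm w * 1"
      by (intro norm_mult_le norm_c) simp
    moreover have "0 \<le> sqrt \<delta>" using delta by simp
    ultimately show ?thesis by linarith
  qed
  moreover have "c * w * c \<in> D" using cs(2) by (intro mult_D)
  ultimately show thesis using that by blast
qed

theorem best_approximation_one:
  assumes lm: "star l * l \<in> D" "star m * m \<in> D"
    and near: "\<And>\<eta>. 0 < \<eta> \<Longrightarrow> \<exists>d\<in>D. norm (l + star m - d) \<le> 1 + \<eta>"
  shows "\<exists>y\<in>D. norm (l + star m - y) \<le> 1"
proof -
  let ?x = "l + star m"
  have step: "\<exists>y'. (y' \<in> D \<and> norm (?x - y') \<le> 1 + (1/4) ^ Suc n) \<and> norm (y' - y) \<le> 6 * (1/2) ^ n"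
    if y: "y \<in> D \<and> norm (?x - y) \<le> 1 + (1/4) ^ n" for y n
  proof -
    have near': "\<exists>d\<in>D. norm (?x - y - d) \<le> 1 + \<eta>" if "0 < \<eta>" for \<eta>
    proof -
      obtain d where d: "d \<in> D" "norm (?x - d) \<le> 1 + \<eta>" using near[OF \<open>0 < \<eta>\<close>] by blast
      then show ?thesis
        using y by (intro bexI[of _ "d - y"]) (simp_all add: D_simps)
    qed
    obtain d where "d \<in> D" "norm d \<le> 6 * sqrt ((1/4) ^ n)" "norm (?x - y - d) \<le> 1 + (1/4) ^ Suc n"
      \<comment> \<open>The approximant reached so far enters as \<open>d0 = - y\<close>.\<close>
      by (rule correction_step[of "?x - y" l m "- y" "(1/4) ^ n" "(1/4) ^ Suc n"])
         (use lm y near' in \<open>simp_all add: D_simps subspace_neg[OF subspace_D] power_le_one\<close>)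
    moreover have "sqrt ((1/4) ^ n) = (1/2) ^ n"
      by (simp add: real_sqrt_power real_sqrt_divide)
    ultimately show ?thesis
      using y by (intro exI[of _ "y + d"]) (simp add: D_simps diff_diff_eq)
  qed
  have "\<exists>y. y \<in> D \<and> norm (?x - y) \<le> 1 + (1/4) ^ 0"
    using near[of 1] by auto
  then obtain Y where Y: "\<And>n. Y n \<in> D \<and> norm (?x - Y n) \<le> 1 + (1/4) ^ n"
      "\<And>n. norm (Y (Suc n) - Y n) \<le> 6 * (1/2) ^ n"
    using dependent_nat_choice[of "\<lambda>n y. y \<in> D \<and> norm (?x - y) \<le> 1 + (1/4) ^ n"
        "\<lambda>n y y'. norm (y' - y) \<le> 6 * (1/2) ^ n"] step by blast
  have "summable (\<lambda>n. 6 * (1/2) ^ n :: real)"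
    by (intro summable_mult summable_geometric) simp
  then have "summable (\<lambda>n. Y (Suc n) - Y n)"
    by (rule summable_comparison_test'[where N = 0]) (rule Y(2))
  then have "convergent (\<lambda>n. \<Sum>k<n. Y (Suc k) - Y k)"
    by (simp add: summable_iff_convergent)
  then have "convergent (\<lambda>n. (Y n - Y 0) + Y 0)"
    unfolding sum_lessThan_telescope by (intro convergent_add convergent_const)
  then obtain y where y: "Y \<longlonglongrightarrow> y" by (auto simp: convergent_def)
  have "y \<in> D" by (rule closed_sequentially[OF closed_D _ y]) (use Y(1) in blast)
  moreover have "norm (?x - y) \<le> 1 + 0"
  proof (rule LIMSEQ_le)
    show "(\<lambda>n. norm (?x - Y n)) \<longlonglongrightarrow> norm (?x - y)" by (intro tendsto_intros y)
    show "(\<lambda>n. 1 + (1/4) ^ n :: real) \<longlonglongrightarrow> 1 + 0" by (intro tendsto_intros LIMSEQ_power_zero) simp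
  qed (use Y(1) in blast)
  ultimately show ?thesis by auto
qed

theorem best_approximation:
  assumes lm: "star l * l \<in> D" "star m * m \<in> D"
  shows "\<exists>y\<in>D. norm (l + star m - y) = infdist (l + star m) D"
proof -
  let ?x = "l + star m"
  have ne: "D \<noteq> {}" using subspace_0[OF subspace_D] by blast
  define \<rho> where "\<rho> = infdist ?x D"
  show ?thesis
  proof (cases "\<rho> = 0")
    case True
    then have "?x \<in> D"
      unfolding \<rho>_def using in_closed_iff_infdist_zero[OF closed_D ne] by blast
    then show ?thesis using True unfolding \<rho>_def by (intro bexI[of _ ?x]) simp_all
  next
    case False
    then have r: "0 < \<rho>" unfolding \<rho>_def using infdist_nonneg by (metis less_eq_real_def)
    let ?l = "(1/\<rho>) *\<^sub>R l" and ?m = "(1/\<rho>) *\<^sub>R m"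
    have scale: "norm (?l + star ?m - d) = norm (?x - \<rho> *\<^sub>R d) / \<rho>" for d
    proof -
      have "?l + star ?m - d = (1/\<rho>) *\<^sub>R (?x - \<rho> *\<^sub>R d)"
        using r by (simp add: star_simps algebra_simps)
      then show ?thesis using r by simp
    qed
    have "\<exists>y\<in>D. norm (?l + star ?m - y) \<le> 1"
    proof (rule best_approximation_one)
      show "star ?l * ?l \<in> D" "star ?m * ?m \<in> D"
        using lm by (simp_all add: star_simps D_simps)
      fix \<eta> :: real assume "0 < \<eta>"
      then have "infdist ?x D < \<rho> * (1 + \<eta>)"
        unfolding \<rho>_def[symmetric] using r by simp
      then obtain d where d: "d \<in> D" "dist ?x d < \<rho> * (1 + \<eta>)"
        unfolding infdist_notempty[OF ne] by (subst (asm) cINF_less_iff[OF ne]) (auto intro: bdd_belowI[of _ 0])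
      then show "\<exists>d\<in>D. norm (?l + star ?m - d) \<le> 1 + \<eta>"
        using r unfolding scale
        by (intro bexI[of _ "(1/\<rho>) *\<^sub>R d"]) (auto simp: dist_norm divide_le_eq mult.commute D_simps)
    qed
    then obtain y where y: "y \<in> D" "norm (?x - \<rho> *\<^sub>R y) \<le> \<rho>"
      unfolding scale using r by (auto simp: divide_le_eq)
    have yD: "\<rho> *\<^sub>R y \<in> D" using y(1) by (rule D_simps)
    moreover have "\<rho> \<le> norm (?x - \<rho> *\<^sub>R y)"
      unfolding \<rho>_def using infdist_le[OF yD] by (simp add: dist_norm \<rho>_def)
    ultimately have "norm (?x - \<rho> *\<^sub>R y) = \<rho>" using y(2) by linarith
    then show ?thesis using yD unfolding \<rho>_def by blast
  qed
qed

end

section \<open>The unitization\<close>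

datatype 'a unitization = Unitization (base: 'a) (scal: complex)

lemma unitization_eqI: "base u = base v \<Longrightarrow> scal u = scal v \<Longrightarrow> u = v"
  by (rule unitization.expand) simp

instantiation unitization :: (cstar_algebra) real_algebra_1
begin

definition "0 = Unitization 0 0"
definition "1 = Unitization 0 1"
definition "u + v = Unitization (base u + base v) (scal u + scal v)"
definition "u - v = Unitization (base u - base v) (scal u - scal v)"
definition "- u = Unitization (- base u) (- scal u)"
definition "u * v = Unitization (base u * base v + scal u *\<^sub>C base v + scal v *\<^sub>C base u) (scal u * scal v)"
definition "r *\<^sub>R u = Unitization (r *\<^sub>R base u) (r *\<^sub>R scal u)"

lemmas unitization_ops = zero_unitization_def one_unitization_def plus_unitization_def
  minus_unitization_def uminus_unitization_def times_unitization_def scaleR_unitization_def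

instance
proof
  fix u v w :: "'a unitization" and r s :: real
  show "u + v + w = u + (v + w)" "u + v = v + u" "0 + u = u" "- u + u = 0" "u - v = u + - v"
    "1 * u = u" "u * 1 = u"
    "r *\<^sub>R (u + v) = r *\<^sub>R u + r *\<^sub>R v" "(r + s) *\<^sub>R u = r *\<^sub>R u + s *\<^sub>R u"
    "r *\<^sub>R s *\<^sub>R u = (r * s) *\<^sub>R u" "1 *\<^sub>R u = u"
    by (simp_all add: unitization_ops algebra_simps scaleC_one)
  show "u * v * w = u * (v * w)" "(u + v) * w = u * w + v * w" "u * (v + w) = u * v + u * w"
    by (simp_all add: unitization_ops algebra_simps scaleC_add_right scaleC_add_left scaleC_scaleC
        mult_scaleC_left mult_scaleC_right)
  show "r *\<^sub>R u * v = r *\<^sub>R (u * v)" "u * r *\<^sub>R v = r *\<^sub>R (u * v)"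
    by (simp_all add: unitization_ops scaleR_scaleC scaleC_add_right scaleC_scaleC
        mult_scaleC_left mult_scaleC_right scaleR_conv_of_real mult_ac)
  show "(0::'a unitization) \<noteq> 1" by (simp add: unitization_ops)
qed

end

lemma unitization_sel [simp]:
  "base 0 = 0" "scal 0 = 0" "base 1 = 0" "scal 1 = 1"
  "base (u + v) = base u + base v" "scal (u + v) = scal u + scal v"
  "base (u - v) = base u - base v" "scal (u - v) = scal u - scal v"
  "base (r *\<^sub>R u) = r *\<^sub>R base u" "scal (r *\<^sub>R u) = r *\<^sub>R scal u"
  "base (u * v) = base u * base v + scal u *\<^sub>C base v + scal v *\<^sub>C base u"
  "scal (u * v) = scal u * scal v"
  by (simp_all add: unitization_ops)

definition act :: "'a::cstar_algebra unitization \<Rightarrow> 'a \<Rightarrow> 'a" where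
  "act u x = base u * x + scal u *\<^sub>C x"

definition unit_star :: "'a::cstar_algebra unitization \<Rightarrow> 'a unitization" where
  "unit_star u = Unitization (star (base u)) (cnj (scal u))"

text \<open>The modulus of the scalar part keeps this a norm when the algebra already has a unit, in which
  case the left regular representation \<open>act\<close> of the unitization is not faithful.\<close>

definition unit_norm :: "'a::cstar_algebra unitization \<Rightarrow> real" where
  "unit_norm u = max (onorm (act u)) (cmod (scal u))"

lemma bounded_linear_act: "bounded_linear (act u)"
proof (rule bounded_linear_intro)
  show "act u (x + y) = act u x + act u y" "act u (r *\<^sub>R x) = r *\<^sub>R act u x" for x y r
    by (simp_all add: act_def algebra_simps scaleC_add_right scaleR_scaleC scaleC_scaleC mult_scaleC_right)
  show "norm (act u x) \<le> norm x * (norm (base u) + cmod (scal u))" for x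
    using norm_triangle_ineq[of "base u * x" "scal u *\<^sub>C x"] norm_mult_ineq[of "base u" x]
    by (simp add: act_def norm_scaleC algebra_simps)
qed

lemma norm_act_le: "norm (act u x) \<le> unit_norm u * norm x"
proof -
  have "norm (act u x) \<le> onorm (act u) * norm x" by (rule onorm[OF bounded_linear_act])
  also have "\<dots> \<le> unit_norm u * norm x" by (intro mult_right_mono) (auto simp: unit_norm_def)
  finally show ?thesis .
qed

lemma onorm_act_le: "onorm (act u) \<le> norm (base u) + cmod (scal u)"
proof (rule onorm_bound)
  show "norm (act u x) \<le> (norm (base u) + cmod (scal u)) * norm x" for x
    using norm_triangle_ineq[of "base u * x" "scal u *\<^sub>C x"] norm_mult_ineq[of "base u" x]
    by (simp add: act_def norm_scaleC algebra_simps)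
qed simp

lemma unit_norm_le: "unit_norm u \<le> norm (base u) + cmod (scal u)"
  using onorm_act_le[of u] by (simp add: unit_norm_def)

lemma scal_le_unit_norm: "cmod (scal u) \<le> unit_norm u"
  by (simp add: unit_norm_def)

text \<open>The lower bound comes from testing left multiplication by \<open>a\<close> on
  \<open>star a\<close>, since there may be no unit to test on.\<close>

lemma unit_norm_base: "unit_norm (Unitization a 0) = norm a"
proof (rule antisym)
  show "unit_norm (Unitization a 0) \<le> norm a"
    using unit_norm_le[of "Unitization a 0"] by simp
  have "norm (a * star a) \<le> unit_norm (Unitization a 0) * norm (star a)"
    using norm_act_le[of "Unitization a 0" "star a"] by (simp add: act_def)
  then have "norm a * norm a \<le> unit_norm (Unitization a 0) * norm a"
    by (simp add: norm_mult_star norm_star power2_eq_square)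
  then show "norm a \<le> unit_norm (Unitization a 0)"
    using scal_le_unit_norm[of "Unitization a 0"] by (cases "a = 0") auto
qed

lemma unit_norm_triangle: "unit_norm (u + v) \<le> unit_norm u + unit_norm v"
proof -
  have "act (u + v) = (\<lambda>x. act u x + act v x)"
    by (auto simp: act_def algebra_simps scaleC_add_left)
  then have "onorm (act (u + v)) \<le> onorm (act u) + onorm (act v)"
    using onorm_triangle[OF bounded_linear_act bounded_linear_act] by simp
  moreover have "cmod (scal (u + v)) \<le> cmod (scal u) + cmod (scal v)"
    by (simp add: norm_triangle_ineq)
  ultimately show ?thesis unfolding unit_norm_def by linarith
qed

lemma unit_norm_scaleC:
  "unit_norm (Unitization (c *\<^sub>C base u) (c * scal u)) = cmod c * unit_norm u"
proof -
  have "act (Unitization (c *\<^sub>C base u) (c * scal u)) = (\<lambda>x. c *\<^sub>C act u x)"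
    by (auto simp: act_def scaleC_add_right scaleC_scaleC mult_scaleC_left)
  moreover have "onorm (\<lambda>x. c *\<^sub>C act u x) = onorm (\<lambda>x. cmod c *\<^sub>R act u x)"
    unfolding onorm_def by (simp add: norm_scaleC)
  ultimately show ?thesis
    unfolding unit_norm_def
    by (simp add: onorm_scaleR[OF bounded_linear_act] norm_mult max_mult_distrib_left)
qed

lemma onorm_act_mult: "onorm (act (u * v)) \<le> onorm (act u) * onorm (act v)"
proof -
  have "act (u * v) = act u \<circ> act v"
    by (auto simp: act_def algebra_simps scaleC_add_right scaleC_add_left scaleC_scaleC
        mult_scaleC_left mult_scaleC_right)
  then show ?thesis using onorm_compose[OF bounded_linear_act bounded_linear_act] by metis
qed

lemma unit_norm_mult: "unit_norm (u * v) \<le> unit_norm u * unit_norm v"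
proof -
  have "onorm (act u) * onorm (act v) \<le> unit_norm u * unit_norm v"
    by (intro mult_mono) (auto simp: unit_norm_def onorm_pos_le[OF bounded_linear_act] intro: max.coboundedI2)
  moreover have "cmod (scal (u * v)) \<le> unit_norm u * unit_norm v"
    by (auto simp: norm_mult unit_norm_def intro!: mult_mono intro: max.coboundedI2)
  ultimately show ?thesis
    using onorm_act_mult[of u v] unfolding unit_norm_def[of "u * v"] by simp
qed

text \<open>Values of \<open>act u\<close> lie in the original algebra, so its C*-identity applies
  to them and moves \<open>u\<close> to the other side as \<open>unit_star u\<close>.\<close>

lemma onorm_act_square: "(onorm (act u))\<^sup>2 \<le> onorm (act (unit_star u * u))"
proof -
  have "norm (act u x) \<le> sqrt (onorm (act (unit_star u * u))) * norm x" for x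
  proof -
    have "star (act u x) * act u x = star x * act (unit_star u * u) x"
      by (simp add: act_def unit_star_def star_simps algebra_simps scaleC_add_right scaleC_scaleC
        mult_scaleC_left mult_scaleC_right)
    then have "(norm (act u x))\<^sup>2 = norm (star x * act (unit_star u * u) x)"
      by (simp flip: cstar_identity)
    also have "\<dots> \<le> norm x * (onorm (act (unit_star u * u)) * norm x)"
      by (intro norm_mult_le onorm[OF bounded_linear_act]) (simp add: norm_star)
    finally have "(norm (act u x))\<^sup>2 \<le> onorm (act (unit_star u * u)) * (norm x)\<^sup>2"
      by (simp add: power2_eq_square mult_ac)
    then have "sqrt ((norm (act u x))\<^sup>2) \<le> sqrt (onorm (act (unit_star u * u)) * (norm x)\<^sup>2)"
      by (rule real_sqrt_le_mono)
    then show ?thesis by (simp add: real_sqrt_mult)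
  qed
  then have "onorm (act u) \<le> sqrt (onorm (act (unit_star u * u)))"
    by (intro onorm_bound) (simp_all add: onorm_pos_le[OF bounded_linear_act])
  then have "(onorm (act u))\<^sup>2 \<le> (sqrt (onorm (act (unit_star u * u))))\<^sup>2"
    by (intro power_mono onorm_pos_le bounded_linear_act)
  then show ?thesis by (simp add: onorm_pos_le[OF bounded_linear_act])
qed

lemma unit_norm_cstar: "unit_norm (unit_star u * u) = (unit_norm u)\<^sup>2"
proof -
  have le: "onorm (act v) \<le> onorm (act (unit_star v))" for v :: "'a unitization"
  proof -
    have "onorm (act v) * onorm (act v) \<le> onorm (act (unit_star v)) * onorm (act v)"
      using onorm_act_square[of v] onorm_act_mult[of "unit_star v" v]
      by (simp add: power2_eq_square)
    then show ?thesis
      using onorm_pos_le[OF bounded_linear_act, of v] onorm_pos_le[OF bounded_linear_act, of "unit_star v"]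
      by (metis less_eq_real_def mult_le_cancel_right_pos)
  qed
  have "unit_star (unit_star u) = u"
    by (simp add: unit_star_def star_star)
  then have "onorm (act (unit_star u)) \<le> onorm (act u)" using le[of "unit_star u"] by simp
  then have "onorm (act (unit_star u)) * onorm (act u) \<le> (onorm (act u))\<^sup>2"
    unfolding power2_eq_square by (intro mult_right_mono onorm_pos_le bounded_linear_act)
  then have "onorm (act (unit_star u * u)) = (onorm (act u))\<^sup>2"
    using onorm_act_mult[of "unit_star u" u] onorm_act_square[of u] by linarith
  moreover have "cmod (scal (unit_star u * u)) = (cmod (scal u))\<^sup>2"
    by (simp add: unit_star_def norm_mult power2_eq_square)
  moreover have "max (a\<^sup>2) (b\<^sup>2) = (max a b)\<^sup>2" if "0 \<le> a" "0 \<le> b" for a b :: real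
    using that by (auto simp: max_def power_mono intro: antisym)
  ultimately show ?thesis
    unfolding unit_norm_def by (simp add: onorm_pos_le[OF bounded_linear_act])
qed

lemma unit_norm_eq_zero: "unit_norm u = 0 \<longleftrightarrow> u = 0"
proof
  assume z: "unit_norm u = 0"
  then have "scal u = 0" using scal_le_unit_norm[of u] by simp
  then have "u = Unitization (base u) 0" by (intro unitization_eqI) simp_all
  then have "norm (base u) = 0" using unit_norm_base[of "base u"] z by simp
  with \<open>scal u = 0\<close> show "u = 0" by (intro unitization_eqI) simp_all
next
  assume "u = 0"
  then show "unit_norm u = 0" using unit_norm_le[of u] scal_le_unit_norm[of u] by simp
qed

text \<open>Subtracting the scalar part costs at most another \<open>unit_norm u\<close>. The bound
  makes the first coordinate continuous, from which completeness follows coordinatewise.\<close>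

lemma norm_base_le: "norm (base u) \<le> 2 * unit_norm u"
proof -
  define v :: "'a unitization" where "v = Unitization 0 (- scal u)"
  have "u + v = Unitization (base u) 0"
    by (intro unitization_eqI) (simp_all add: v_def)
  then have "norm (base u) \<le> unit_norm u + unit_norm v"
    using unit_norm_triangle[of u v] by (simp add: unit_norm_base)
  moreover have "unit_norm v \<le> unit_norm u"
    using unit_norm_le[of v] scal_le_unit_norm[of u] by (simp add: v_def)
  ultimately show ?thesis by simp
qed

instantiation unitization :: (cstar_algebra) real_normed_algebra_1
begin

definition "norm u = unit_norm u"
definition "dist u v = unit_norm (u - v)"
definition "sgn u = inverse (unit_norm u) *\<^sub>R u"
definition "uniformity = (INF e\<in>{0<..}. principal {(u, v). dist u (v :: 'a unitization) < e})"
definition "open S = (\<forall>u\<in>S. \<forall>\<^sub>F (u', v) in uniformity. u' = u \<longrightarrow> (v :: 'a unitization) \<in> S)"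

instance
proof
  fix u v :: "'a unitization" and r :: real
  show "dist u v = norm (u - v)" "sgn u = u /\<^sub>R norm u"
    "uniformity = (INF e\<in>{0<..}. principal {(u, v). dist u (v :: 'a unitization) < e})"
    by (simp_all add: norm_unitization_def dist_unitization_def sgn_unitization_def uniformity_unitization_def)
  show "open S = (\<forall>u\<in>S. \<forall>\<^sub>F (u', v) in uniformity. u' = u \<longrightarrow> v \<in> S)" for S :: "'a unitization set"
    by (rule open_unitization_def)
  show "norm u = 0 \<longleftrightarrow> u = 0" "norm (u + v) \<le> norm u + norm v" "norm (u * v) \<le> norm u * norm v"
    by (simp_all add: norm_unitization_def unit_norm_eq_zero unit_norm_triangle unit_norm_mult)
  have "r *\<^sub>R u = Unitization (complex_of_real r *\<^sub>C base u) (complex_of_real r * scal u)"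
    by (intro unitization_eqI)
      (simp_all add: scaleR_scaleC[of r "base u"] scaleR_conv_of_real[of r "scal u"])
  then show "norm (r *\<^sub>R u) = \<bar>r\<bar> * norm u"
    by (simp add: norm_unitization_def unit_norm_scaleC)
  show "norm (1 :: 'a unitization) = 1"
    using unit_norm_le[of "1 :: 'a unitization"] scal_le_unit_norm[of "1 :: 'a unitization"]
    by (simp add: norm_unitization_def)
qed

end

instance unitization :: (cstar_algebra) banach
proof
  fix X :: "nat \<Rightarrow> 'a unitization"
  assume X: "Cauchy X"
  have "bounded_linear (base :: 'a unitization \<Rightarrow> 'a)"
    by (rule bounded_linear_intro[of _ 2]) (simp_all add: norm_unitization_def norm_base_le mult.commute[of _ 2])
  then obtain a where a: "(\<lambda>n. base (X n)) \<longlonglongrightarrow> a"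
    using bounded_linear.Cauchy[OF _ X] Cauchy_convergent convergent_def by blast
  have "bounded_linear (scal :: 'a unitization \<Rightarrow> complex)"
    by (rule bounded_linear_intro[of _ 1]) (simp_all add: norm_unitization_def scal_le_unit_norm)
  then obtain z where z: "(\<lambda>n. scal (X n)) \<longlonglongrightarrow> z"
    using bounded_linear.Cauchy[OF _ X] Cauchy_convergent convergent_def by blast
  have "(\<lambda>n. norm (base (X n) - a) + cmod (scal (X n) - z)) \<longlonglongrightarrow> norm (a - a) + cmod (z - z)"
    by (intro tendsto_intros a z)
  then have lim: "(\<lambda>n. norm (base (X n) - a) + cmod (scal (X n) - z)) \<longlonglongrightarrow> 0" by simp
  have "(\<lambda>n. X n - Unitization a z) \<longlonglongrightarrow> 0"
  proof (rule Lim_null_comparison[OF _ lim])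
    show "\<forall>\<^sub>F n in sequentially. norm (X n - Unitization a z) \<le> norm (base (X n) - a) + cmod (scal (X n) - z)"
      unfolding norm_unitization_def using unit_norm_le[of "X _ - Unitization a z"] by simp
  qed
  then show "convergent X"
    using LIM_zero_iff convergent_def by blast
qed

instantiation unitization :: (cstar_algebra) unital_cstar_algebra
begin

definition "c *\<^sub>C u = Unitization (c *\<^sub>C base u) (c * scal u)"
definition "star u = unit_star u"

instance
proof
  fix u v :: "'a unitization" and r :: real and c d :: complex
  show "r *\<^sub>R u = complex_of_real r *\<^sub>C u"
    by (intro unitization_eqI)
      (simp_all add: scaleC_unitization_def scaleR_scaleC[of r "base u"] scaleR_conv_of_real[of r "scal u"])
  show "norm (c *\<^sub>C u) = cmod c * norm u"
    by (simp add: scaleC_unitization_def norm_unitization_def unit_norm_scaleC)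
  show "norm (star u * u) = (norm u)\<^sup>2"
    by (simp add: norm_unitization_def star_unitization_def unit_norm_cstar)
  show "c *\<^sub>C (u + v) = c *\<^sub>C u + c *\<^sub>C v" "(c + d) *\<^sub>C u = c *\<^sub>C u + d *\<^sub>C u"
    "c *\<^sub>C d *\<^sub>C u = (c * d) *\<^sub>C u" "c *\<^sub>C u * v = c *\<^sub>C (u * v)" "u * c *\<^sub>C v = c *\<^sub>C (u * v)"
    by (intro unitization_eqI; simp add: scaleC_unitization_def scaleC_add_right scaleC_add_left
        scaleC_scaleC mult_scaleC_left mult_scaleC_right algebra_simps)+
  show "star (star u) = u" "star (u + v) = star u + star v" "star (c *\<^sub>C u) = cnj c *\<^sub>C star u"
    "star (u * v) = star v * star u"
    by (intro unitization_eqI; simp add: scaleC_unitization_def star_unitization_def unit_star_def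
        star_simps algebra_simps)+
qed

end

definition incl :: "'a::cstar_algebra \<Rightarrow> 'a unitization" where
  "incl a = Unitization a 0"

lemma incl_simps:
  "incl a + incl b = incl (a + b)" "incl a - incl b = incl (a - b)" "incl a * incl b = incl (a * b)"
  "r *\<^sub>R incl a = incl (r *\<^sub>R a)" "star (incl a) = incl (star a)" "incl 0 = 0" "norm (incl a) = norm a"
  by (auto simp: incl_def star_unitization_def unit_star_def norm_unitization_def unit_norm_base
      intro!: unitization_eqI)

lemma bounded_linear_incl: "bounded_linear incl"
  by (rule bounded_linear_intro[of _ 1]) (simp_all add: incl_simps)

section \<open>Hereditary subalgebras\<close>

lemma cstar_positive_two_scale: "cstar_positive (2 *\<^sub>R (star d * d))"
proof -
  have "2 *\<^sub>R (star d * d) = star (sqrt 2 *\<^sub>R d) * (sqrt 2 *\<^sub>R d)"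
    by (simp add: star_scaleR)
  then show ?thesis unfolding cstar_positive_def by blast
qed

text \<open>The element \<open>(1 - g) d\<close>, where \<open>1 - g\<close> is the square root of \<open>1 - b\<close> in the unitization,
  lies in the algebra itself.\<close>

lemma cstar_positive_compression:
  fixes b :: "'a::cstar_algebra"
  assumes "star b = b" "norm b \<le> 1"
  shows "cstar_positive (star d * d - star d * b * d)"
proof -
  define g where "g = root_defect b"
  have sg: "star g = g" unfolding g_def by (rule star_root_defect[OF assms(2,1)])
  have b: "b = 2 *\<^sub>R g - g * g" unfolding g_def using root_defect_eq[OF assms(2)] by simp
  have "star d * d - star d * b * d = star (d - g * d) * (d - g * d)"
    unfolding b by (simp add: star_simps sg algebra_simps scaleR_2)
  then show ?thesis unfolding cstar_positive_def by blast
qed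

text \<open>As \<open>b\<close> and \<open>- b\<close> are both contractions,
  \<open>star d * d - star d * b * d\<close> lies between \<open>0\<close> and
  \<open>2 *\<^sub>R (star d * d)\<close>. Both inequalities hold in the order of the algebra
  itself, as heredity requires, because the compressed roots belong to it.\<close>

lemma hereditary_compression_unit:
  assumes D: "hereditary_subalgebra D" and d: "d \<in> D" and b: "star b = b" "norm b \<le> 1"
  shows "star d * b * d \<in> D"
proof -
  have sub: "complex_vector.subspace D" and mult: "\<And>x y. x \<in> D \<Longrightarrow> y \<in> D \<Longrightarrow> x * y \<in> D"
    and st: "\<And>x. x \<in> D \<Longrightarrow> star x \<in> D"
    using D by (auto simp: hereditary_subalgebra_def cstar_subalgebra_def)
  have dd: "star d * d \<in> D" using d mult st by blast
  have two: "2 *\<^sub>R (star d * d) \<in> D"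
    using complex_vector.subspace_scale[OF sub dd, of 2] by (simp add: scaleR_scaleC)
  have "cstar_positive (star d * d - star d * (- b) * d)"
    using b by (intro cstar_positive_compression) (simp_all add: star_minus)
  then have "cstar_le (star d * d - star d * b * d) (2 *\<^sub>R (star d * d))"
    unfolding cstar_le_def by (simp add: scaleR_2 algebra_simps)
  then have "star d * d - star d * b * d \<in> D"
    using D two cstar_positive_two_scale cstar_positive_compression[OF b]
    unfolding hereditary_subalgebra_def by blast
  then have "star d * d - (star d * d - star d * b * d) \<in> D"
    by (rule complex_vector.subspace_diff[OF sub dd])
  then show ?thesis by simp
qed

lemma hereditary_compression:
  assumes D: "hereditary_subalgebra D" and d: "d \<in> D"
  shows "star d * b * d \<in> D"
proof -
  have sub: "complex_vector.subspace D"
    using D by (auto simp: hereditary_subalgebra_def cstar_subalgebra_def)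
  have sa: "star d * q * d \<in> D" if "star q = q" for q
  proof (cases "q = 0")
    case True
    then show ?thesis using complex_vector.subspace_0[OF sub] by simp
  next
    case False
    have "star d * ((1 / norm q) *\<^sub>R q) * d \<in> D"
      by (rule hereditary_compression_unit[OF D d]) (simp_all add: star_scaleR that)
    from complex_vector.subspace_scale[OF sub this, of "complex_of_real (norm q)"] show ?thesis
      using False by (simp flip: scaleR_scaleC)
  qed
  obtain p q where pq: "star p = p" "star q = q" "b = p + \<i> *\<^sub>C q"
    by (rule star_real_part)
  have "star d * b * d = star d * p * d + \<i> *\<^sub>C (star d * q * d)"
    unfolding pq(3) by (simp add: algebra_simps mult_scaleC_left mult_scaleC_right)
  then show ?thesis
    using sa pq complex_vector.subspace_add[OF sub] complex_vector.subspace_scale[OF sub] by metis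
qed

text \<open>Polarisation of the sesquilinear map \<open>(d, e) \<mapsto> d\<^sup>* b e\<close>.\<close>

lemma hereditary_mult:
  assumes D: "hereditary_subalgebra D" and d: "d \<in> D" and e: "e \<in> D"
  shows "d * b * e \<in> D"
proof -
  have sub: "complex_vector.subspace D" and st: "\<And>x. x \<in> D \<Longrightarrow> star x \<in> D"
    using D by (auto simp: hereditary_subalgebra_def cstar_subalgebra_def)
  note add = complex_vector.subspace_add[OF sub] and diff = complex_vector.subspace_diff[OF sub]
    and scale = complex_vector.subspace_scale[OF sub]
  define f where "f = star d"
  have f: "f \<in> D" unfolding f_def using d st by blast
  define T where "T u v = star u * b * v" for u v
  have T: "T u u \<in> D" if "u \<in> D" for u
    unfolding T_def by (rule hereditary_compression[OF D that])
  have "T (f + e) (f + e) - T f f - T e e \<in> D"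
    by (intro diff T add f e)
  also have "T (f + e) (f + e) - T f f - T e e = T f e + T e f"
    unfolding T_def by (simp add: star_simps algebra_simps)
  finally have plus: "T f e + T e f \<in> D" .
  have "(- \<i>) *\<^sub>C (T (f + \<i> *\<^sub>C e) (f + \<i> *\<^sub>C e) - T f f - T e e) \<in> D"
    by (intro scale diff T add f e)
  also have "(- \<i>) *\<^sub>C (T (f + \<i> *\<^sub>C e) (f + \<i> *\<^sub>C e) - T f f - T e e) = T f e - T e f"
    unfolding T_def
    by (simp add: star_simps algebra_simps mult_scaleC_left mult_scaleC_right scaleC_scaleC
        scaleC_minus_left scaleC_one scaleC_add_right complex_vector.scale_right_diff_distrib)
  finally have minus: "T f e - T e f \<in> D" .
  have "(1/2) *\<^sub>C ((T f e + T e f) + (T f e - T e f)) \<in> D"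
    by (intro scale add plus minus)
  also have "(1/2) *\<^sub>C ((T f e + T e f) + (T f e - T e f)) = T f e"
  proof -
    have "(T f e + T e f) + (T f e - T e f) = 2 *\<^sub>R T f e" by (simp add: scaleR_2)
    then show ?thesis by (simp only: scaleR_scaleC scaleC_scaleC) (simp add: scaleC_one)
  qed
  finally show ?thesis unfolding T_def f_def by (simp add: star_star)
qed

lemma hereditary_corner_incl:
  assumes D: "hereditary_subalgebra D"
  shows "hereditary_corner (incl ` D)"
proof
  have sub: "complex_vector.subspace D" and st: "\<And>x. x \<in> D \<Longrightarrow> star x \<in> D" and cl: "closed D"
    and mult: "\<And>x y. x \<in> D \<Longrightarrow> y \<in> D \<Longrightarrow> x * y \<in> D"
    using D by (auto simp: hereditary_subalgebra_def cstar_subalgebra_def)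
  have rsub: "subspace D"
    unfolding subspace_def
    using complex_vector.subspace_0[OF sub] complex_vector.subspace_add[OF sub]
      complex_vector.subspace_scale[OF sub] by (simp add: scaleR_scaleC)
  show "subspace (incl ` D)"
    by (rule linear_subspace_image[OF bounded_linear.linear[OF bounded_linear_incl] rsub])
  show "closed (incl ` D)"
    by (intro complete_imp_closed complete_isometric_image[OF zero_less_one rsub bounded_linear_incl])
       (use cl in \<open>simp_all add: incl_simps complete_eq_closed\<close>)
  show "star d \<in> incl ` D" if "d \<in> incl ` D" for d
    using that st by (auto simp: incl_simps)
  show "d * u * e \<in> incl ` D" if mem: "d \<in> incl ` D" "e \<in> incl ` D" for d u e
  proof -
    obtain d' e' where de: "d = incl d'" "e = incl e'" "d' \<in> D" "e' \<in> D" using mem by blast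
    have "d * u * e = incl (d' * base u * e' + scal u *\<^sub>C (d' * e'))"
      unfolding de(1,2) incl_def
      by (intro unitization_eqI) (simp_all add: algebra_simps mult_scaleC_left mult_scaleC_right)
    moreover have "d' * base u * e' + scal u *\<^sub>C (d' * e') \<in> D"
      by (rule complex_vector.subspace_add[OF sub hereditary_mult[OF D de(3,4)]
            complex_vector.subspace_scale[OF sub mult[OF de(3,4)]]])
    ultimately show ?thesis by blast
  qed
qed

section \<open>The left ideal associated with \<open>D\<close>\<close>

lemma subspace_closed_product: "complex_vector.subspace (closed_product S T)"
proof -
  define V where "V = complex_vector.span {s * t | s t. s \<in> S \<and> t \<in> T}"
  have V: "complex_vector.subspace V" unfolding V_def by simp
  show ?thesis
    unfolding closed_product_def V_def[symmetric]
  proof (rule complex_vector.subspaceI)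
    show "0 \<in> closure V"
      using complex_vector.subspace_0[OF V] closure_subset by blast
    show "x + y \<in> closure V" if xy: "x \<in> closure V" "y \<in> closure V" for x y
    proof -
      obtain f g where "\<And>n. f n \<in> V" "f \<longlonglongrightarrow> x" "\<And>n. g n \<in> V" "g \<longlonglongrightarrow> y"
        using xy unfolding closure_sequential by metis
      then show ?thesis
        unfolding closure_sequential using complex_vector.subspace_add[OF V] tendsto_add
        by (intro exI[of _ "\<lambda>n. f n + g n"]) auto
    qed
    show "c *\<^sub>C x \<in> closure V" if x: "x \<in> closure V" for c x
    proof -
      obtain f where f: "\<And>n. f n \<in> V" "f \<longlonglongrightarrow> x"
        using x unfolding closure_sequential by metis
      have "bounded_linear (\<lambda>x :: 'a. c *\<^sub>C x)"
        by (rule bounded_linear_intro[of _ "cmod c"])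
           (simp_all add: scaleC_add_right norm_scaleC scaleR_scaleC scaleC_scaleC mult.commute)
      then have "(\<lambda>n. c *\<^sub>C f n) \<longlonglongrightarrow> c *\<^sub>C x" by (rule bounded_linear.tendsto) (rule f(2))
      then show ?thesis
        unfolding closure_sequential using complex_vector.subspace_scale[OF V f(1)]
        by (intro exI[of _ "\<lambda>n. c *\<^sub>C f n"]) simp
    qed
  qed
qed

text \<open>For generators, \<open>star (s * t) * (s' * t')\<close> has its outer factors
  \<open>star t\<close> and \<open>t'\<close> in \<open>D\<close>, so \<open>hereditary_mult\<close>
  applies; linearity in each variable and continuity do the rest. This is the only information about
  the ideal that the approximation argument uses.\<close>

lemma closed_product_star_mult:
  assumes D: "hereditary_subalgebra D" and l: "l \<in> closed_product UNIV D"
  shows "star l * l \<in> D"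
proof -
  define V where "V = complex_vector.span {s * t | s t. s \<in> (UNIV :: 'a set) \<and> t \<in> D}"
  have sub: "complex_vector.subspace D" and st: "\<And>x. x \<in> D \<Longrightarrow> star x \<in> D" and cl: "closed D"
    using D by (auto simp: hereditary_subalgebra_def cstar_subalgebra_def)
  have gen: "star (s * t) * (s' * t') \<in> D" if "t \<in> D" "t' \<in> D" for s t s' t'
    using hereditary_mult[OF D st[OF that(1)] that(2), of "star s * s'"]
    by (simp add: star_mult mult.assoc)
  have half: "star (s * t) * q \<in> D" if "t \<in> D" "q \<in> V" for s t q
    using that(2) unfolding V_def
  proof (induction rule: complex_vector.span_induct)
    case base
    show ?case
      by (rule complex_vector.subspaceI)
         (use complex_vector.subspace_0[OF sub] complex_vector.subspace_add[OF sub]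
            complex_vector.subspace_scale[OF sub] in \<open>simp_all add: distrib_left mult_scaleC_right\<close>)
  next
    case (step q)
    then show ?case using gen that(1) by auto
  qed
  have full: "star p * q \<in> D" if "q \<in> V" "p \<in> V" for p q
    using that(2) unfolding V_def
  proof (induction rule: complex_vector.span_induct)
    case base
    show ?case
      by (rule complex_vector.subspaceI)
         (use complex_vector.subspace_0[OF sub] complex_vector.subspace_add[OF sub]
            complex_vector.subspace_scale[OF sub]
          in \<open>simp_all add: star_simps distrib_right mult_scaleC_left\<close>)
  next
    case (step p)
    then show ?case using half that(1) by auto
  qed
  obtain f where f: "\<And>n. f n \<in> V" "f \<longlonglongrightarrow> l"
    using l unfolding closed_product_def V_def[symmetric] closure_sequential by metis
  have "(\<lambda>n. star (f n) * f n) \<longlonglongrightarrow> star l * l"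
    by (intro tendsto_intros star_tendsto f)
  then show ?thesis
    by (rule closed_sequentially[OF cl, rotated]) (intro full f(1))
qed

text \<open>The square of \<open>c\<close> acts as an approximate unit: \<open>d - d * c * c\<close>
  is \<open>d * s * s\<close>, which is small, and \<open>d * c * c\<close> ends in a factor from
  \<open>D\<close>.\<close>

lemma hereditary_subset_closed_product:
  assumes D: "hereditary_subalgebra D"
  shows "D \<subseteq> closed_product UNIV D"
proof
  fix d assume d: "d \<in> D"
  interpret hereditary_corner "incl ` D" by (rule hereditary_corner_incl[OF D])
  let ?d = "incl d"
  have mem: "star ?d * ?d \<in> incl ` D" using d by (intro mult2_D star_D) auto
  have gen: "d * u * v \<in> complex_vector.span {s * t | s t. s \<in> (UNIV :: 'a set) \<and> t \<in> D}" if "v \<in> D" for u v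
    by (rule complex_vector.span_base) (use that in blast)
  show "d \<in> closed_product UNIV D"
    unfolding closed_product_def closure_approachable
  proof (intro allI impI)
    fix e :: real assume e: "0 < e"
    then have "0 < (e / 2)\<^sup>2" by simp
    from partition_exists[OF mem pos_star_mult this] obtain c s
      where cs: "partition_pair c s" "c \<in> incl ` D" "norm (s * (star ?d * ?d) * s) \<le> (e / 2)\<^sup>2"
      by blast
    interpret partition_pair c s by (rule cs(1))
    obtain c' where c': "c = incl c'" "c' \<in> D" using cs(2) by blast
    have "star (?d * s) * (?d * s) = s * (star ?d * ?d) * s"
      by (simp add: star_mult sa mult.assoc)
    then have "(norm (?d * s))\<^sup>2 \<le> (e / 2)\<^sup>2" using cs(3) by (simp flip: cstar_identity)
    then have "norm (?d * s) \<le> e / 2" by (rule power2_le_imp_le) (use e in simp)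
    then have "norm (?d * s * s) \<le> e / 2 * 1" using norm_s by (rule norm_mult_le)
    moreover have "?d * s * s = incl (d - d * c' * c')"
    proof -
      have "?d * s * s = ?d - ?d * c * c"
        using part by (metis add_diff_cancel_left' mult.assoc mult_1_right right_diff_distrib)
      then show ?thesis unfolding c'(1) by (simp add: incl_simps)
    qed
    ultimately have "norm (d - d * c' * c') \<le> e / 2" by (simp add: incl_simps)
    then show "\<exists>y\<in>complex_vector.span {s * t | s t. s \<in> (UNIV :: 'a set) \<and> t \<in> D}. dist y d < e"
      using gen[OF c'(2), of c'] e
      by (intro bexI[of _ "d * c' * c'"]) (auto simp: dist_norm norm_minus_commute)
  qed
qed

theorem theorem4p11:
  fixes D L :: "'a::cstar_algebra set"
  assumes "hereditary_subalgebra D"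
    and "L = closed_product UNIV D"
  shows "proximinal D {x + star y | x y. x \<in> L \<and> y \<in> L}"
proof -
  have sub: "complex_vector.subspace D"
    using assms(1) by (auto simp: hereditary_subalgebra_def cstar_subalgebra_def)
  have L: "complex_vector.subspace L" unfolding assms(2) by (rule subspace_closed_product)
  let ?X = "{x + star y | x y. x \<in> L \<and> y \<in> L}"
  have "complex_vector.subspace ?X"
  proof (rule complex_vector.subspaceI)
    show "0 \<in> ?X"
      using complex_vector.subspace_0[OF L] by (force simp: star_zero)
    show "u + v \<in> ?X" if uv: "u \<in> ?X" "v \<in> ?X" for u v
    proof -
      obtain x y x' y' where "u = x + star y" "v = x' + star y'" "x \<in> L" "y \<in> L" "x' \<in> L" "y' \<in> L"
        using uv by blast
      moreover from this have "u + v = (x + x') + star (y + y')" by (simp add: star_add)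
      ultimately show ?thesis using complex_vector.subspace_add[OF L] by blast
    qed
    show "c *\<^sub>C u \<in> ?X" if u: "u \<in> ?X" for c u
    proof -
      obtain x y where "u = x + star y" "x \<in> L" "y \<in> L" using u by blast
      moreover from this have "c *\<^sub>C u = c *\<^sub>C x + star (cnj c *\<^sub>C y)"
        by (simp add: star_scaleC scaleC_add_right)
      ultimately show ?thesis using complex_vector.subspace_scale[OF L] by blast
    qed
  qed
  moreover have "D \<subseteq> ?X"
  proof
    fix d assume "d \<in> D"
    then have "d \<in> L" unfolding assms(2) using hereditary_subset_closed_product[OF assms(1)] by blast
    moreover have "d = d + star 0" by (simp add: star_zero)
    ultimately show "d \<in> ?X" using complex_vector.subspace_0[OF L] by blast
  qed
  moreover have "\<exists>y\<in>D. norm (x - y) = infdist x D" if x: "x \<in> ?X" for x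
  proof -
    obtain l m where lm: "x = l + star m" "l \<in> L" "m \<in> L" using x by blast
    interpret hereditary_corner "incl ` D" by (rule hereditary_corner_incl[OF assms(1)])
    have "star (incl l) * incl l \<in> incl ` D" "star (incl m) * incl m \<in> incl ` D"
      using lm(2,3) closed_product_star_mult[OF assms(1)] unfolding assms(2)
      by (auto simp: incl_simps)
    from best_approximation[OF this] obtain y
      where y: "y \<in> D" "norm (incl x - incl y) = infdist (incl x) (incl ` D)"
      unfolding lm(1) by (auto simp: incl_simps)
    moreover have "infdist (incl x) (incl ` D) = infdist x D"
      unfolding infdist_def by (simp add: image_image dist_norm incl_simps)
    ultimately show ?thesis by (auto simp: incl_simps)
  qed
  ultimately show ?thesis
    unfolding proximinal_def using sub by blast
qed

end
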